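(* Every $3$-vexillary permutation is multiplicity free.
   Context: Let $s_i=(i\ i{+}1)$, $\ell(w)$ the Coxeter length, and $\mathrm{Red}(w)$ the set of reduced words of a permutation $w$: sequences $a=(a_1,\dots,a_{\ell(w)})$ with $s_{a_1}\cdots s_{a_{\ell(w)}}=w$ (right multiplication by $s_i$ swaps the entries in positions $i$ and $i+1$). For $a\in\mathrm{Red}(w)$ let $I(a)$ be the set of integer sequences $1\le i_1\le\cdots\le i_{\ell(w)}$ such that $i_j<i_{j+1}$ whenever $a_j<a_{j+1}$. The Stanley symmetric function is $F_w=\sum_{a\in\mathrm{Red}(w)}\sum_{i\in I(a)}x_{i_1}\cdots x_{i_{\ell(w)}}$. It is symmetric with Schur expansion $F_w=\sum_\lambda a_{w\lambda}s_\lambda$, where the $a_{w\lambda}$ are nonnegative integers. The Edelman-Greene number is $EG(w)=\sum_\lambda a_{w\lambda}$. A permutation $w$ is $3$-vexillary if $EG(w)\le 3$, and multiplicity free if all nonzero coefficients $a_{w\lambda}$ equal $1$. *)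

theory Defs
  imports "HOL-Library.Multiset" "HOL-Combinatorics.Permutations"
begin

text \<open>
  Permutations in one-line notation are functions \<open>w :: nat \<Rightarrow> nat\<close> with \<open>w permutes {1..n}\<close>;
  composing with \<open>simple i\<close> on the right swaps the entries in positions \<open>i\<close> and \<open>i + 1\<close>.
\<close>

definition simple :: "nat \<Rightarrow> nat \<Rightarrow> nat" where
  "simple i = Transposition.transpose i (Suc i)"

definition word_perm :: "nat list \<Rightarrow> nat \<Rightarrow> nat" where
  "word_perm a = foldr (\<lambda>i v. simple i \<circ> v) a id"

text \<open>Letters start at 1; in particular \<open>simple 0\<close> is not a generator.\<close>

definition words_of :: "(nat \<Rightarrow> nat) \<Rightarrow> nat list set" where
  "words_of w = {a. (\<forall>i\<in>set a. 1 \<le> i) \<and> word_perm a = w}"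

definition coxeter_length :: "(nat \<Rightarrow> nat) \<Rightarrow> nat" where
  "coxeter_length w = (LEAST k. \<exists>a\<in>words_of w. length a = k)"

definition reduced_words :: "(nat \<Rightarrow> nat) \<Rightarrow> nat list set" where
  "reduced_words w = {a \<in> words_of w. length a = coxeter_length w}"

definition compatible_seqs :: "nat list \<Rightarrow> nat list set" where
  "compatible_seqs a = {i. length i = length a \<and> (\<forall>k\<in>set i. 1 \<le> k) \<and> sorted i \<and>
     (\<forall>j. Suc j < length a \<longrightarrow> a ! j < a ! Suc j \<longrightarrow> i ! j < i ! Suc j)}"

text \<open>
  A formal power series in \<open>x\<^sub>1, x\<^sub>2, \<dots>\<close> with coefficients in \<open>nat\<close> is represented by its
  coefficient function on monomials; the multiset \<open>{#i\<^sub>1, \<dots>, i\<^sub>l#}\<close> stands for the monomial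
  \<open>x\<^sub>i\<^sub>1 \<cdots> x\<^sub>i\<^sub>l\<close>. A sum of monomials over an index set thus becomes, at each monomial, the
  number of indices contributing it.
\<close>

type_synonym power_series = "nat multiset \<Rightarrow> nat"

definition stanley :: "(nat \<Rightarrow> nat) \<Rightarrow> power_series" where
  "stanley w m =
     card {(a, i). a \<in> reduced_words w \<and> i \<in> compatible_seqs a \<and> mset i = m}"

definition is_partition :: "nat list \<Rightarrow> bool" where
  "is_partition \<mu> \<longleftrightarrow> sorted_wrt (\<ge>) \<mu> \<and> 0 \<notin> set \<mu>"

text \<open>Semistandard Young tableaux in English notation, given as lists of rows.\<close>

definition ssyt :: "nat list \<Rightarrow> nat list list set" where
  "ssyt \<mu> = {T. map length T = \<mu> \<and> (\<forall>r\<in>set T. sorted r \<and> (\<forall>k\<in>set r. 1 \<le> k)) \<and>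
     (\<forall>i j. Suc i < length T \<longrightarrow> j < length (T ! Suc i) \<longrightarrow> T ! i ! j < T ! Suc i ! j)}"

definition schur :: "nat list \<Rightarrow> power_series" where
  "schur \<mu> m = card {T \<in> ssyt \<mu>. mset (concat T) = m}"

definition has_schur_expansion :: "power_series \<Rightarrow> (nat list \<Rightarrow> nat) \<Rightarrow> bool" where
  "has_schur_expansion F c \<longleftrightarrow>
     finite {\<mu>. c \<mu> \<noteq> 0} \<and> (\<forall>\<mu>. c \<mu> \<noteq> 0 \<longrightarrow> is_partition \<mu>) \<and>
     (\<forall>m. F m = (\<Sum>\<mu> | c \<mu> \<noteq> 0. c \<mu> * schur \<mu> m))"

text \<open>
  For a permutation \<open>w\<close> there is exactly one \<open>c\<close> with \<open>has_schur_expansion (stanley w) c\<close>: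
  existence (with coefficients in \<open>nat\<close>) is the theorem of Edelman and Greene, uniqueness is the
  linear independence of the Schur functions. The value \<open>c \<mu>\<close> is the coefficient of the Schur
  function of \<open>\<mu>\<close> in \<open>stanley w\<close>. The coefficients and their sum, the Edelman-Greene number of
  \<open>w\<close>, are treated relationally, so that no default value is involved.
\<close>

definition has_EG_number :: "(nat \<Rightarrow> nat) \<Rightarrow> nat \<Rightarrow> bool" where
  "has_EG_number w N \<longleftrightarrow>
     (\<exists>c. has_schur_expansion (stanley w) c \<and> N = (\<Sum>\<mu> | c \<mu> \<noteq> 0. c \<mu>))"

definition vexillary :: "nat \<Rightarrow> (nat \<Rightarrow> nat) \<Rightarrow> bool" where
  "vexillary k w \<longleftrightarrow> (\<exists>N. has_EG_number w N \<and> N \<le> k)"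

definition multiplicity_free :: "(nat \<Rightarrow> nat) \<Rightarrow> bool" where
  "multiplicity_free w \<longleftrightarrow>
     (\<exists>c. has_schur_expansion (stanley w) c) \<and>
     (\<forall>c. has_schur_expansion (stanley w) c \<longrightarrow> (\<forall>\<mu>. c \<mu> \<noteq> 0 \<longrightarrow> c \<mu> = 1))"

end

theory Submission
  imports Defs
begin

text \<open>
  Both sides of the Schur expansion count pairs of a word and a compatible sequence: the words are
  the reduced words of \<open>w\<close> on the one side, the Yamanouchi words of shape \<open>\<mu>\<close> on the other. The
  expansion is therefore an identity between numbers of words with prescribed ascents.

  Counting words that are concatenations of decreasing blocks of given lengths shows that the
  expansion has a dominance-greatest shape and that its coefficient is 1: multiplying \<open>w\<close> by the
  letters of a decreasing block lowers each entry of its code at most once, and exactly one reduced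
  word has as block lengths the conjugate of the code. Increasing blocks give in the same way a
  dominance-least shape with coefficient 1. If the two shapes agree, no other shape occurs;
  otherwise they contribute 2 to an Edelman-Greene number that is at most 3, so that every
  remaining coefficient is at most 1.
\<close>

section \<open>Series of words and ascent sets\<close>

text \<open>A coefficient of the series counts words in weakly decreasing blocks, so the greatest
  shape is visible in single coefficients. Increasing blocks are coefficients of the image under the
  involution omega and cannot be read off one monomial; this is why both sides are resolved down to
  ascent sets. On the Schur side the block counts are the Kostka numbers K(\<mu>, \<alpha>) and, for
  increasing blocks, K(\<mu>', \<alpha>) with \<mu>' the conjugate shape. They vanish unless \<mu>,
  or \<mu>', dominates \<alpha>. The least shape is thus handled as the greatest one after
  conjugation, where the sum of min(\<mu>_i, k) is the size of the first k columns. Every comparison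
  of shapes passes through the conjugate of a code: it bounds the block lengths of all reduced
  words, and it is itself bounded by the shape that its own unique word contributes. The definition
  of \<open>multiplicity_free\<close> speaks of every expansion, while \<open>vexillary\<close>
  supplies a single one; uniqueness of the expansion closes this gap.\<close>

definition words_series :: "nat list set \<Rightarrow> power_series" where
  "words_series W m = card {(a, i). a \<in> W \<and> i \<in> compatible_seqs a \<and> mset i = m}"

definition ascents :: "nat list \<Rightarrow> nat set" where
  "ascents a = {j. Suc j < length a \<and> a ! j < a ! Suc j}"

text \<open>Lengths are compared as well because words of different lengths can share an ascent
  set.\<close>

definition asc_invariant :: "(nat list \<Rightarrow> bool) \<Rightarrow> bool" where
  "asc_invariant Q \<longleftrightarrow>
     (\<forall>a b. length a = length b \<longrightarrow> ascents a = ascents b \<longrightarrow> Q a \<longrightarrow> Q b)"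

lemma finite_ascents [simp]: "finite (ascents a)"
  by (rule finite_subset[of _ "{..<length a}"]) (auto simp: ascents_def)

text \<open>The sequence \<open>s\<close> rises exactly after the positions in \<open>S\<close> and
  is the only sorted arrangement of its multiset. Its monomial therefore counts the words that
  ascend only where \<open>s\<close> rises.\<close>

lemma words_series_ascents_subset:
  fixes S :: "nat set" and l :: nat
  defines "s \<equiv> map (\<lambda>j. Suc (card (S \<inter> {..<j}))) [0..<l]"
  shows "words_series W (mset s) = card {a \<in> W. length a = l \<and> ascents a \<subseteq> S}"
proof -
  have sorted: "sorted s"
    by (auto simp: s_def sorted_iff_nth_mono intro!: card_mono)
  have step: "s ! j < s ! Suc j \<longleftrightarrow> j \<in> S" if "Suc j < l" for j
  proof -
    have "S \<inter> {..<Suc j} = (if j \<in> S then insert j (S \<inter> {..<j}) else S \<inter> {..<j})"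
      by (auto simp: less_Suc_eq)
    then show ?thesis using that by (auto simp: s_def)
  qed
  have s_compatible: "s \<in> compatible_seqs a \<longleftrightarrow> length a = l \<and> ascents a \<subseteq> S" for a
    using sorted step by (auto simp: compatible_seqs_def ascents_def s_def)
  have unique: "i = s" if "i \<in> compatible_seqs a" "mset i = mset s" for a i
    using that sorted properties_for_sort[of i s] by (auto simp: compatible_seqs_def sorted_sort_id)
  have "{(a, i). a \<in> W \<and> i \<in> compatible_seqs a \<and> mset i = mset s} =
      {(a, i). i = s \<and> a \<in> W \<and> s \<in> compatible_seqs a}"
    using unique by blast
  also have "\<dots> = (\<lambda>a. (a, s)) ` {a \<in> W. length a = l \<and> ascents a \<subseteq> S}"
    by (auto simp: s_compatible)
  finally show ?thesis
    by (simp add: words_series_def card_image inj_on_def)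
qed

lemma card_ascents_subset:
  assumes "finite W" "finite S"
  shows "card {a \<in> W. length a = l \<and> ascents a \<subseteq> S} =
    (\<Sum>U\<in>Pow S. card {a \<in> W. length a = l \<and> ascents a = U})"
proof -
  have "{a \<in> W. length a = l \<and> ascents a \<subseteq> S} =
      (\<Union>U\<in>Pow S. {a \<in> W. length a = l \<and> ascents a = U})"
    by auto
  moreover have "card (\<Union>U\<in>Pow S. {a \<in> W. length a = l \<and> ascents a = U}) =
      (\<Sum>U\<in>Pow S. card {a \<in> W. length a = l \<and> ascents a = U})"
    using assms by (intro card_UN_disjoint) auto
  ultimately show ?thesis by simp
qed

text \<open>
  Only the numbers of words with a given ascent set enter the series, so an identity between
  series carries over to the counts of words with any property that the ascent set decides;
  the case \<open>ascents a = S\<close> is Moebius inversion.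
\<close>

lemma card_words_transfer:
  fixes V :: "'i \<Rightarrow> nat list set"
  assumes W: "finite W" and V: "\<And>x. x \<in> I \<Longrightarrow> finite (V x)"
    and eq: "\<And>m. words_series W m = (\<Sum>x\<in>I. c x * words_series (V x) m)"
    and Q: "asc_invariant Q"
  shows "card {a \<in> W. length a = l \<and> Q a} = (\<Sum>x\<in>I. c x * card {a \<in> V x. length a = l \<and> Q a})"
proof -
  define E where "E W' S = card {a \<in> W'. length a = l \<and> ascents a = S}" for W' S
  have exact: "E W S = (\<Sum>x\<in>I. c x * E (V x) S)" if "finite S" for S
    using that
  proof (induction S rule: finite_psubset_induct)
    case (psubset S)
    have sum_Pow: "(\<Sum>U\<in>Pow S. f U) = f S + (\<Sum>U\<in>Pow S - {S}. f U)" for f :: "nat set \<Rightarrow> nat"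
      using psubset.hyps by (subst sum.remove[of _ S]) auto
    have series: "words_series W' (mset (map (\<lambda>j. Suc (card (S \<inter> {..<j}))) [0..<l])) =
        (\<Sum>U\<in>Pow S. E W' U)" if "finite W'" for W'
      unfolding E_def
      using that psubset.hyps by (simp only: words_series_ascents_subset card_ascents_subset)
    have "(\<Sum>U\<in>Pow S. E W U) = (\<Sum>x\<in>I. c x * (\<Sum>U\<in>Pow S. E (V x) U))"
      using eq unfolding series[OF W, symmetric] by (simp only: series[OF V] cong: sum.cong)
    also have "\<dots> = (\<Sum>U\<in>Pow S. \<Sum>x\<in>I. c x * E (V x) U)"
      by (simp add: sum_distrib_left) (rule sum.swap)
    finally have "E W S + (\<Sum>U\<in>Pow S - {S}. E W U) =
        (\<Sum>x\<in>I. c x * E (V x) S) + (\<Sum>U\<in>Pow S - {S}. \<Sum>x\<in>I. c x * E (V x) U)"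
      by (simp add: sum_Pow)
    moreover have "(\<Sum>U\<in>Pow S - {S}. E W U) = (\<Sum>U\<in>Pow S - {S}. \<Sum>x\<in>I. c x * E (V x) U)"
      by (rule sum.cong) (auto intro: psubset.IH)
    ultimately show ?case by simp
  qed
  \<comment> \<open>A property decided by the ascent set is replaced by the set of ascent sets it
    admits. For words of length \<open>l\<close> these lie below \<open>l\<close>, so the count is a
    finite sum of exact counts.\<close>
  define G where "G = {S \<in> Pow {..<l}. \<exists>a. length a = l \<and> ascents a = S \<and> Q a}"
  have "finite G"
    unfolding G_def by simp
  have count: "card {a \<in> W'. length a = l \<and> Q a} = (\<Sum>S\<in>G. E W' S)" if "finite W'" for W'
  proof -
    have Q_iff: "ascents a \<in> G \<longleftrightarrow> Q a" if "length a = l" for a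
    proof
      assume "ascents a \<in> G"
      then obtain b where "length b = l" "ascents b = ascents a" "Q b"
        by (auto simp: G_def)
      then show "Q a"
        using Q that unfolding asc_invariant_def by metis
    next
      assume "Q a"
      moreover have "ascents a \<in> Pow {..<l}"
        using that by (auto simp: ascents_def)
      ultimately show "ascents a \<in> G"
        using that unfolding G_def by blast
    qed
    have "{a \<in> W'. length a = l \<and> Q a} = (\<Union>S\<in>G. {a \<in> W'. length a = l \<and> ascents a = S})"
      by (auto simp: Q_iff)
    then show ?thesis
      unfolding E_def using that \<open>finite G\<close> by (subst card_UN_disjoint[symmetric]) auto
  qed
  have "finite S" if "S \<in> G" for S
    using that by (auto simp: G_def intro: finite_subset[OF _ finite_lessThan])
  then have "(\<Sum>S\<in>G. E W S) = (\<Sum>S\<in>G. \<Sum>x\<in>I. c x * E (V x) S)"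
    by (intro sum.cong) (auto intro: exact)
  also have "\<dots> = (\<Sum>x\<in>I. c x * (\<Sum>S\<in>G. E (V x) S))"
    by (simp add: sum_distrib_left) (rule sum.swap)
  finally show ?thesis
    using W V by (simp only: count cong: sum.cong)
qed

section \<open>Words in monotone blocks\<close>

text \<open>Block lengths may be 0. With \<open>(\<ge>)\<close> the words are those compatible with
  the sequence that equals j on the j-th block, so their number is the coefficient of the monomial
  with exponents \<open>\<alpha>\<close>.\<close>

definition blocks :: "(nat \<Rightarrow> nat \<Rightarrow> bool) \<Rightarrow> nat list \<Rightarrow> nat list \<Rightarrow> bool" where
  "blocks R \<alpha> a \<longleftrightarrow>
     (\<exists>bs. concat bs = a \<and> map length bs = \<alpha> \<and> (\<forall>b\<in>set bs. sorted_wrt R b))"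

lemma blocks_Nil [simp]: "blocks R [] a \<longleftrightarrow> a = []"
  by (auto simp: blocks_def)

lemma blocks_Cons:
  "blocks R (k # \<alpha>) a \<longleftrightarrow> (\<exists>b a'. a = b @ a' \<and> length b = k \<and> sorted_wrt R b \<and> blocks R \<alpha> a')"
proof
  assume "blocks R (k # \<alpha>) a"
  then obtain b bs where "concat (b # bs) = a" "length b = k" "map length bs = \<alpha>"
      "\<forall>b\<in>set (b # bs). sorted_wrt R b"
    unfolding blocks_def by (auto simp: map_eq_Cons_conv)
  then show "\<exists>b a'. a = b @ a' \<and> length b = k \<and> sorted_wrt R b \<and> blocks R \<alpha> a'"
    unfolding blocks_def by (intro exI[of _ b] exI[of _ "concat bs"]) auto
next
  assume "\<exists>b a'. a = b @ a' \<and> length b = k \<and> sorted_wrt R b \<and> blocks R \<alpha> a'"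
  then obtain b bs where "a = b @ concat bs" "length b = k" "map length bs = \<alpha>"
      "sorted_wrt R b" "\<forall>b\<in>set bs. sorted_wrt R b"
    unfolding blocks_def by auto
  then show "blocks R (k # \<alpha>) a"
    unfolding blocks_def by (intro exI[of _ "b # bs"]) auto
qed

lemma blocks_snoc:
  assumes "blocks R \<alpha> a" "sorted_wrt R b"
  shows "blocks R (\<alpha> @ [length b]) (a @ b)"
proof -
  obtain bs where "concat bs = a" "map length bs = \<alpha>" "\<forall>b\<in>set bs. sorted_wrt R b"
    using assms(1) by (auto simp: blocks_def)
  then show ?thesis
    unfolding blocks_def using assms(2) by (intro exI[of _ "bs @ [b]"]) auto
qed

lemma length_blocks: "blocks R \<alpha> a \<Longrightarrow> length a = sum_list \<alpha>"
  by (auto simp: blocks_def length_concat)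

lemma blocks_rev: "blocks (<) (rev \<alpha>) a \<longleftrightarrow> blocks (>) \<alpha> (rev a)"
proof -
  have *: "blocks R (rev \<alpha>) (rev a)" if R': "blocks R' \<alpha> a" "\<And>x y. R x y \<longleftrightarrow> R' y x"
    for R R' \<alpha> and a :: "nat list"
  proof -
    obtain bs where "concat bs = a" "map length bs = \<alpha>" "\<forall>b\<in>set bs. sorted_wrt R' b"
      using R'(1) by (auto simp: blocks_def)
    then show ?thesis
      unfolding blocks_def using R'(2)
      by (intro exI[of _ "rev (map rev bs)"])
        (auto simp: rev_concat rev_map sorted_wrt_rev comp_def)
  qed
  show ?thesis
    using *[of "(>)" \<alpha> "rev a" "(<)"] *[of "(<)" "rev \<alpha>" a "(>)"] by auto
qed

lemma asc_invariant_blocks: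
  assumes "\<And>a b. length a = length b \<Longrightarrow> ascents a = ascents b \<Longrightarrow> sorted_wrt R a \<Longrightarrow> sorted_wrt R b"
  shows "asc_invariant (blocks R \<alpha>)"
proof -
  \<comment> \<open>The ascents of a prefix or a suffix are those of the whole word, restricted or
    shifted; hence the ascent set of every block is determined.\<close>
  have asc_append: "ascents a = ascents (a @ b) \<inter> {j. Suc j < length a}"
      "ascents a = {j. j + length b \<in> ascents (b @ a)}" for a b
    by (auto simp: ascents_def nth_append)
  have "blocks R \<alpha> b" if "length a = length b" "ascents a = ascents b" "blocks R \<alpha> a" for a b
    using that
  proof (induction \<alpha> arbitrary: a b)
    case Nil
    then show ?case by simp
  next
    case (Cons k \<alpha>)
    then obtain a1 a2 where a: "a = a1 @ a2" "length a1 = k" "sorted_wrt R a1" "blocks R \<alpha> a2"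
      by (auto simp: blocks_Cons)
    define b1 b2 where "b1 = take k b" and "b2 = drop k b"
    have b: "b = b1 @ b2" "length b1 = k" "length a2 = length b2"
      using a Cons.prems(1) by (auto simp: b1_def b2_def)
    have "ascents a1 = ascents b1" "ascents a2 = ascents b2"
      unfolding asc_append(1)[of a1 a2] asc_append(1)[of b1 b2] asc_append(2)[of a2 a1]
        asc_append(2)[of b2 b1] a(1)[symmetric] b(1)[symmetric] Cons.prems(2)
      using a b by auto
    then have "sorted_wrt R b1" "blocks R \<alpha> b2"
      using assms[of a1 b1] Cons.IH[of a2 b2] a b by auto
    then show ?case
      using b by (auto simp: blocks_Cons)
  qed
  then show ?thesis
    unfolding asc_invariant_def by blast
qed

text \<open>Weak decrease means that there is no ascent. Strict decrease is invisible to ascent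
  sets, since equal neighbours form no ascent either; strictness is recovered later for reduced
  words only.\<close>

lemma asc_invariant_blocks_ge: "asc_invariant (blocks (\<ge>) \<alpha>)"
proof (rule asc_invariant_blocks)
  have "sorted_wrt (\<ge>) a \<longleftrightarrow> (\<forall>i. Suc i < length a \<longrightarrow> a ! i \<ge> a ! Suc i)" for a :: "nat list"
    by (rule sorted_wrt_iff_nth_Suc_transp) (auto simp: transp_def)
  moreover have "(\<forall>i. Suc i < length a \<longrightarrow> a ! i \<ge> a ! Suc i) \<longleftrightarrow> ascents a = {}" for a :: "nat list"
    unfolding ascents_def by (auto simp flip: not_less)
  ultimately have "sorted_wrt (\<ge>) a \<longleftrightarrow> ascents a = {}" for a by blast
  then show "sorted_wrt (\<ge>) b" if "ascents a = ascents b" "sorted_wrt (\<ge>) a" for a b :: "nat list"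
    using that by simp
qed

lemma asc_invariant_blocks_less: "asc_invariant (blocks (<) \<alpha>)"
proof (rule asc_invariant_blocks)
  have "sorted_wrt (<) a \<longleftrightarrow> ascents a = {j. Suc j < length a}" for a
    by (subst sorted_wrt_iff_nth_Suc_transp) (auto simp: ascents_def transp_def)
  then show "sorted_wrt (<) b"
    if "length a = length b" "ascents a = ascents b" "sorted_wrt (<) a" for a b :: "nat list"
    using that by simp
qed

section \<open>Conjugate partitions\<close>

text \<open>The column lengths of the diagram with rows \<open>f v\<close>. The rows need not be
  sorted, which suits codes, and a generous bound \<open>K\<close> only appends zeros.\<close>

definition conjugate :: "'a set \<Rightarrow> ('a \<Rightarrow> nat) \<Rightarrow> nat \<Rightarrow> nat list" where
  "conjugate V f K = map (\<lambda>j. card {v \<in> V. j < f v}) [0..<K]"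

text \<open>Both sides count the cells in the first \<open>k\<close> columns, by columns and by
  rows.\<close>

lemma sum_list_take_conjugate:
  assumes "finite V" "\<And>v. v \<in> V \<Longrightarrow> f v \<le> K"
  shows "sum_list (take k (conjugate V f K)) = (\<Sum>v\<in>V. min (f v) k)"
proof -
  have "sum_list (take k (conjugate V f K)) = (\<Sum>j<min k K. card {v \<in> V. j < f v})"
    by (cases "k \<le> K") (simp_all add: conjugate_def take_map interv_sum_list_conv_sum_set_nat
        atLeast0LessThan min_def)
  also have "\<dots> = (\<Sum>j<min k K. \<Sum>v\<in>V. if j < f v then 1 else 0)"
    using assms(1) by (simp add: sum.If_cases Int_def)
  also have "\<dots> = (\<Sum>v\<in>V. \<Sum>j<min k K. if j < f v then 1 else 0)"
    by (rule sum.swap)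
  also have "\<dots> = (\<Sum>v\<in>V. min (f v) k)"
  proof (rule sum.cong)
    fix v assume "v \<in> V"
    then have "{..<min k K} \<inter> {j. j < f v} = {..<min (f v) k}"
      using assms(2)[of v] by auto
    then show "(\<Sum>j<min k K. if j < f v then 1 else 0) = min (f v) k"
      by (simp add: sum.If_cases)
  qed simp
  finally show ?thesis .
qed

section \<open>Codes and reduced words\<close>

definition inversions :: "(nat \<Rightarrow> nat) \<Rightarrow> (nat \<times> nat) set" where
  "inversions w = {(u, v). u < v \<and> w v < w u}"

text \<open>A variant of the Lehmer code: it counts the larger entries to the left of position
  \<open>v\<close>, so each inversion is charged to its right end.\<close>

definition code :: "(nat \<Rightarrow> nat) \<Rightarrow> nat \<Rightarrow> nat" where
  "code w v = card {u. (u, v) \<in> inversions w}"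

definition fin_perm :: "(nat \<Rightarrow> nat) \<Rightarrow> bool" where
  "fin_perm w \<longleftrightarrow> (\<exists>n. w permutes {1..n})"

definition left_descent :: "(nat \<Rightarrow> nat) \<Rightarrow> nat \<Rightarrow> bool" where
  "left_descent w b \<longleftrightarrow> inv w (Suc b) < inv w b"

lemma fin_perm_bij: "fin_perm w \<Longrightarrow> bij w"
  by (auto simp: fin_perm_def permutes_bij)

lemma fin_perm_0: "fin_perm w \<Longrightarrow> w 0 = 0"
  by (auto simp: fin_perm_def permutes_def)

lemma simple_apply: "simple b x = (if x = b then Suc b else if x = Suc b then b else x)"
  by (simp add: simple_def Transposition.transpose_def)

lemma simple_simple [simp]: "simple b (simple b x) = x"
  by (simp add: simple_apply)

text \<open>Left multiplication exchanges two values and keeps all positions, so the code, which is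
  indexed by positions, can be followed entry by entry along a word.\<close>

definition smul :: "nat \<Rightarrow> (nat \<Rightarrow> nat) \<Rightarrow> nat \<Rightarrow> nat" where
  "smul b w = simple b \<circ> w"

lemma smul_apply: "smul b w x = simple b (w x)"
  by (simp add: smul_def)

lemma smul_smul [simp]: "smul b (smul b w) = w"
  by (simp add: fun_eq_iff smul_apply)

lemma fin_perm_smul:
  assumes "fin_perm w" "1 \<le> b"
  shows "fin_perm (smul b w)"
proof -
  obtain n where n: "w permutes {1..n}"
    using assms by (auto simp: fin_perm_def)
  have "w permutes {1..n + b + 1}"
    using n by (rule permutes_subset) auto
  moreover have "simple b permutes {1..n + b + 1}"
    unfolding simple_def using assms(2) by (intro permutes_swap_id) auto
  ultimately show ?thesis
    unfolding fin_perm_def smul_def by (blast intro: permutes_compose)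
qed

lemma finite_inversions:
  assumes "fin_perm w"
  shows "finite (inversions w)"
proof -
  obtain n where n: "w permutes {1..n}"
    using assms by (auto simp: fin_perm_def)
  have bound: "v \<le> n" if "u < v" "w v < w u" for u v
  proof (rule ccontr)
    assume "\<not> v \<le> n"
    then have "w v = v" using n by (auto simp: permutes_def)
    moreover have "w u = u \<or> w u \<le> n"
      using n permutes_in_image[OF n, of u] by (auto simp: permutes_def)
    ultimately show False using that \<open>\<not> v \<le> n\<close> by auto
  qed
  have "inversions w \<subseteq> {..n} \<times> {..n}"
    using bound by (fastforce simp: inversions_def)
  then show ?thesis by (rule finite_subset) auto
qed

lemma finite_inversions_fiber:
  "finite {u. (u, v) \<in> inversions w}"
  by (rule finite_subset[of _ "{..<v}"]) (auto simp: inversions_def)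

lemma code_pos_iff: "0 < code w v \<longleftrightarrow> (\<exists>u<v. w v < w u)"
  using finite_inversions_fiber[of v w] by (auto simp: code_def card_gt_0_iff inversions_def)

lemma finite_code_pos:
  assumes "fin_perm w"
  shows "finite {v. 0 < code w v}"
proof -
  have "{v. 0 < code w v} \<subseteq> snd ` inversions w"
    by (auto simp: code_pos_iff inversions_def image_iff)
  then show ?thesis
    using finite_inversions[OF assms] by (meson finite_imageI finite_subset)
qed

lemma card_inversions:
  assumes "finite V" "{v. 0 < code w v} \<subseteq> V"
  shows "card (inversions w) = (\<Sum>v\<in>V. code w v)"
proof -
  have "inversions w = (\<lambda>(v, u). (u, v)) ` (SIGMA v:V. {u. (u, v) \<in> inversions w})"
    using assms(2) by (force simp: code_pos_iff inversions_def image_iff)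
  then have "card (inversions w) = card (SIGMA v:V. {u. (u, v) \<in> inversions w})"
    by (metis (mono_tags, lifting) card_image inj_on_def prod.inject case_prod_conv prod.collapse split_beta)
  then show ?thesis
    using assms(1) finite_inversions_fiber by (simp add: code_def)
qed

text \<open>Exchanging the values \<open>b\<close> and \<open>Suc b\<close> leaves their comparison
  with every other value unchanged. Only the pair of positions holding these two can become or cease
  to be an inversion.\<close>

lemma inversions_smul:
  assumes "bij w"
  shows "left_descent w b \<Longrightarrow> (inv w (Suc b), inv w b) \<in> inversions w"
    and "left_descent w b \<Longrightarrow>
      inversions (smul b w) = inversions w - {(inv w (Suc b), inv w b)}"
    and "\<not> left_descent w b \<Longrightarrow>
      inversions (smul b w) = insert (inv w b, inv w (Suc b)) (inversions w)"
    and "\<not> left_descent w b \<Longrightarrow> (inv w b, inv w (Suc b)) \<notin> inversions w"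
proof -
  have w: "w (inv w x) = x" "inv w (w x) = x" "w x = y \<longleftrightarrow> x = inv w y" for x y
    using assms by (auto simp: bij_is_inj bij_is_surj surj_f_inv_f inv_f_f)
  have ne: "inv w b \<noteq> inv w (Suc b)"
    using w(1) by (metis n_not_Suc_n)
  show "left_descent w b \<Longrightarrow> (inv w (Suc b), inv w b) \<in> inversions w"
    "\<not> left_descent w b \<Longrightarrow> (inv w b, inv w (Suc b)) \<notin> inversions w"
    using ne by (auto simp: inversions_def w(1) left_descent_def)
  have simple_less: "simple b y < simple b x \<longleftrightarrow> y < x"
    if "\<not> (x = b \<and> y = Suc b)" "\<not> (x = Suc b \<and> y = b)" for x y
    using that by (auto simp: simple_apply)
  have other: "x \<in> inversions (smul b w) \<longleftrightarrow> x \<in> inversions w"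
    if "x \<noteq> (inv w (Suc b), inv w b)" "x \<noteq> (inv w b, inv w (Suc b))" for x
    using that simple_less[of "w (fst x)" "w (snd x)"] by (cases x) (auto simp: inversions_def smul_apply w(3))
  have special: "(inv w (Suc b), inv w b) \<notin> inversions (smul b w)"
    "(inv w b, inv w (Suc b)) \<in> inversions (smul b w) \<longleftrightarrow> inv w b < inv w (Suc b)"
    "(inv w b, inv w (Suc b)) \<notin> inversions w"
    "(inv w (Suc b), inv w b) \<in> inversions w \<longleftrightarrow> inv w (Suc b) < inv w b"
    by (auto simp: inversions_def w(1) smul_apply simple_apply)
  have "x \<in> inversions (smul b w) \<longleftrightarrow> x \<in> inversions w - {(inv w (Suc b), inv w b)}"
    if "left_descent w b" for x
    using other[of x] special that ne unfolding left_descent_def Diff_iff singleton_iff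
    by (metis less_asym)
  then show "left_descent w b \<Longrightarrow>
      inversions (smul b w) = inversions w - {(inv w (Suc b), inv w b)}"
    by blast
  have "x \<in> inversions (smul b w) \<longleftrightarrow> x \<in> insert (inv w b, inv w (Suc b)) (inversions w)"
    if "\<not> left_descent w b" for x
    using other[of x] special that ne unfolding left_descent_def insert_iff
    by (metis nat_neq_iff)
  then show "\<not> left_descent w b \<Longrightarrow>
      inversions (smul b w) = insert (inv w b, inv w (Suc b)) (inversions w)"
    by blast
qed

lemma card_inversions_smul:
  assumes "fin_perm w"
  shows "card (inversions (smul b w)) =
    (if left_descent w b then card (inversions w) - 1 else Suc (card (inversions w)))"
  using inversions_smul[OF fin_perm_bij[OF assms], of b] finite_inversions[OF assms]
  by (auto simp: card_Diff_singleton)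

text \<open>The inversion that disappears has the position of the value \<open>b\<close> as its
  right end, so only the code there drops.\<close>

lemma code_smul:
  assumes "fin_perm w" "left_descent w b"
  shows "code (smul b w) v + (if w v = b then 1 else 0) = code w v"
proof -
  have inv: "w v = b \<longleftrightarrow> v = inv w b" for v
    using fin_perm_bij[OF assms(1)] by (metis bij_inv_eq_iff)
  note * = inversions_smul(1,2)[OF fin_perm_bij[OF assms(1)] assms(2)]
  show ?thesis
  proof (cases "w v = b")
    case True
    then have "{u. (u, v) \<in> inversions w} =
        insert (inv w (Suc b)) {u. (u, v) \<in> inversions (smul b w)}"
      using * inv by auto
    then show ?thesis
      using True finite_inversions_fiber[of v "smul b w"] * inv by (simp add: code_def)
  next
    case False
    then have "{u. (u, v) \<in> inversions w} = {u. (u, v) \<in> inversions (smul b w)}"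
      using * inv by auto
    then show ?thesis
      using False by (simp add: code_def)
  qed
qed

lemma word_perm_Nil [simp]: "word_perm [] = id"
  and word_perm_Cons [simp]: "word_perm (b # a) = smul b (word_perm a)"
  by (simp_all add: word_perm_def smul_def)

lemma fin_perm_id: "fin_perm id"
  by (auto simp: fin_perm_def intro: permutes_id)

lemma fin_perm_word_perm: "\<forall>i\<in>set a. 1 \<le> i \<Longrightarrow> fin_perm (word_perm a)"
  by (induction a) (auto intro: fin_perm_id fin_perm_smul)

lemma inversions_id [simp]: "inversions id = {}"
  by (auto simp: inversions_def)

lemma card_inversions_word_perm:
  "\<forall>i\<in>set a. 1 \<le> i \<Longrightarrow> card (inversions (word_perm a)) \<le> length a"
proof (induction a)
  case (Cons b a)
  then show ?case
    using card_inversions_smul[OF fin_perm_word_perm[of a], of b] by (auto split: if_splits)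
qed simp

text \<open>Without inversions both \<open>w\<close> and \<open>inv w\<close> are strictly
  increasing, hence both lie above the identity.\<close>

lemma fin_perm_no_inversions:
  assumes "fin_perm w" "inversions w = {}"
  shows "w = id"
proof -
  have w: "w (inv w x) = x" "inv w (w x) = x" for x
    using fin_perm_bij[OF assms(1)] by (auto simp: bij_is_inj bij_is_surj surj_f_inv_f inv_f_f)
  have mono: "w u < w v" if "u < v" for u v
  proof -
    have "(u, v) \<notin> inversions w"
      using assms(2) by simp
    then have "w u \<le> w v"
      using that by (simp add: inversions_def)
    moreover have "w u \<noteq> w v"
      using that w(2)[of u] w(2)[of v] by auto
    ultimately show ?thesis by simp
  qed
  have inv_mono: "inv w u < inv w v" if "u < v" for u v
    using mono[of "inv w v" "inv w u"] that w(1)[of u] w(1)[of v]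
    by (cases "inv w u" "inv w v" rule: linorder_cases) auto
  have "x \<le> w x" "x \<le> inv w x" for x
    by (rule strict_mono_imp_increasing, rule strict_monoI, fact mono)
      (rule strict_mono_imp_increasing, rule strict_monoI, fact inv_mono)
  then have "w x = x" for x
    using w(2)[of x] by (metis order_antisym)
  then show ?thesis
    by auto
qed

section \<open>Reduced words as paths of descents to the identity\<close>

text \<open>The letters are stripped off \<open>w\<close> from the left: the result is the inverse
  of \<open>word_perm b\<close> followed by composition with \<open>w\<close>, that is
  \<open>inv (word_perm b) \<circ> w\<close>, and it is \<open>id\<close> exactly for the words of
  \<open>w\<close>.\<close>

definition act :: "(nat \<Rightarrow> nat) \<Rightarrow> nat list \<Rightarrow> nat \<Rightarrow> nat" where
  "act w b = foldl (\<lambda>v i. smul i v) w b"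

text \<open>Every letter removes one inversion. Combined with \<open>act w a = id\<close> this is
  reducedness in a form that can be followed letter by letter.\<close>

fun descents :: "(nat \<Rightarrow> nat) \<Rightarrow> nat list \<Rightarrow> bool" where
  "descents w [] \<longleftrightarrow> True"
| "descents w (b # a) \<longleftrightarrow> 1 \<le> b \<and> left_descent w b \<and> descents (smul b w) a"

lemma act_simps [simp]:
  "act w [] = w" "act w (b # a) = act (smul b w) a" "act w (a @ c) = act (act w a) c"
  by (simp_all add: act_def)

lemma descents_append [simp]: "descents w (a @ b) \<longleftrightarrow> descents w a \<and> descents (act w a) b"
  by (induction a arbitrary: w) auto

lemma fin_perm_act: "fin_perm w \<Longrightarrow> descents w a \<Longrightarrow> fin_perm (act w a)"
  by (induction a arbitrary: w) (auto simp: fin_perm_smul)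

lemma card_inversions_act:
  "fin_perm w \<Longrightarrow> descents w a \<Longrightarrow> card (inversions (act w a)) + length a = card (inversions w)"
proof (induction a arbitrary: w)
  case (Cons b a)
  have "0 < card (inversions w)"
    using inversions_smul(1)[OF fin_perm_bij[OF Cons.prems(1)], of b] Cons.prems
      finite_inversions[OF Cons.prems(1)] by (auto simp: card_gt_0_iff)
  then show ?case
    using Cons.IH[of "smul b w"] card_inversions_smul[OF Cons.prems(1), of b] Cons.prems
    by (auto simp: fin_perm_smul)
qed simp

lemma act_eq_id_iff: "act w a = id \<longleftrightarrow> word_perm a = w"
proof (induction a arbitrary: w)
  case (Cons b a)
  have "word_perm a = smul b w \<longleftrightarrow> smul b (word_perm a) = w"
    by (metis smul_smul)
  then show ?case
    using Cons by simp
qed auto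

lemma descents_letters: "descents w a \<Longrightarrow> \<forall>i\<in>set a. 1 \<le> i"
  by (induction a arbitrary: w) auto

text \<open>There is no slack: a first letter that is not a left descent would leave more inversions
  than there are letters to remove them.\<close>

lemma descents_shortest:
  assumes "\<forall>i\<in>set a. 1 \<le> i" "length a = card (inversions (word_perm a))"
  shows "descents (word_perm a) a"
  using assms
proof (induction a)
  case (Cons b a)
  have fin: "fin_perm (word_perm (b # a))" and bound: "card (inversions (word_perm a)) \<le> length a"
    using Cons.prems fin_perm_word_perm[of "b # a"] card_inversions_word_perm[of a] by auto
  have "left_descent (word_perm (b # a)) b"
    using card_inversions_smul[OF fin, of b] bound Cons.prems(2) by (auto split: if_splits)
  moreover have "length a = card (inversions (word_perm a))"
    using card_inversions_smul[OF fin, of b] calculation Cons.prems(2) by auto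
  ultimately show ?case
    using Cons by simp
qed simp

lemma inv_smul:
  fixes w :: "nat \<Rightarrow> nat"
  assumes "bij w"
  shows "inv (smul b w) x = inv w (simple b x)"
proof -
  have "w (inv w y) = y" "inv w (w y) = y" for y
    using assms by (auto simp: bij_is_inj bij_is_surj surj_f_inv_f inv_f_f)
  then have "inv (smul b w) = (\<lambda>x. inv w (simple b x))"
    by (intro inv_equality) (auto simp: smul_apply)
  then show ?thesis by simp
qed

section \<open>Decreasing blocks against the code\<close>

text \<open>After the letter \<open>x\<close> the values \<open>x\<close> and \<open>Suc x\<close>
  have changed places, so \<open>x\<close> is no longer a left descent and cannot follow at
  once.\<close>

lemma descents_sorted_strict:
  assumes "fin_perm w" "descents w b" "sorted_wrt (\<ge>) b"
  shows "sorted_wrt (>) b"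
  using assms
proof (induction b arbitrary: w)
  case (Cons x b)
  have IH: "sorted_wrt (>) b"
    using Cons.IH[of "smul x w"] Cons.prems by (auto simp: fin_perm_smul)
  have "y < x" if "y \<in> set b" for y
  proof (cases b)
    case (Cons z c)
    then have "left_descent w x" "left_descent (smul x w) z"
      using Cons.prems by auto
    then have "z \<noteq> x"
      using inv_smul[OF fin_perm_bij[OF Cons.prems(1)], of x]
      by (auto simp: left_descent_def simple_apply)
    moreover have "z \<le> x" "y \<le> z"
      using Cons Cons.prems(3) that by auto
    ultimately show ?thesis by simp
  qed (use that in simp)
  then show ?case
    using IH by simp
qed simp

lemma descents_blocks_strict:
  assumes "fin_perm w" "descents w a" "blocks (\<ge>) \<alpha> a"
  shows "blocks (>) \<alpha> a"
  using assms
proof (induction \<alpha> arbitrary: w a)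
  case (Cons k \<alpha>)
  then obtain b c where "a = b @ c" "length b = k" "sorted_wrt (\<ge>) b" "blocks (\<ge>) \<alpha> c"
    by (auto simp: blocks_Cons)
  then show ?case
    using Cons.prems Cons.IH[of "act w b" c] descents_sorted_strict[of w b]
    by (auto simp: blocks_Cons fin_perm_act)
qed simp

lemma blocks_strict_weak:
  assumes "blocks (>) \<alpha> a"
  shows "blocks (\<ge>) \<alpha> a"
proof -
  have "sorted_wrt (\<ge>) b" if "sorted_wrt (>) b" for b :: "nat list"
    using that by (rule sorted_wrt_mono_rel[rotated]) simp
  then show ?thesis
    using assms unfolding blocks_def by blast
qed

text \<open>
  The element of \<open>w\<close> whose code drops at the letter \<open>x\<close> is the one with value \<open>x\<close> at that time.
  Larger letters do not move it, so along a decreasing word each code drops at most once.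
\<close>

lemma code_act:
  assumes "fin_perm w" "descents w b" "sorted_wrt (>) b"
  shows "code (act w b) v + (if w v \<in> set b then 1 else 0) = code w v"
  using assms
proof (induction b arbitrary: w)
  case (Cons x b)
  have small: "y < x" if "y \<in> set b" for y
    using Cons.prems(3) that by simp
  have "smul x w v \<in> set b \<longleftrightarrow> w v \<in> set b"
    using small[of x] small[of "Suc x"] by (auto simp: smul_apply simple_apply)
  moreover have "w v \<noteq> x" if "w v \<in> set b"
    using small that by auto
  ultimately show ?case
    using Cons.IH[of "smul x w"] Cons.prems code_smul[of w x v]
    by (auto simp: fin_perm_smul split: if_splits)
qed simp

lemma inv_act_less:
  assumes "fin_perm w" "descents w b" "\<forall>x\<in>set b. y < x"
  shows "inv (act w b) y = inv w y"
  using assms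
proof (induction b arbitrary: w)
  case (Cons x b)
  then show ?case
    using inv_smul[OF fin_perm_bij[OF Cons.prems(1)], of x y]
    by (auto simp: fin_perm_smul simple_apply)
qed simp

text \<open>The block is built from the largest value down. The invariant that the entry holding the
  current value has code 0 makes the next smaller value a left descent as soon as its own code is
  positive.\<close>

lemma exists_maximal_decreasing_block:
  assumes "fin_perm w"
  shows "\<exists>b. sorted_wrt (>) b \<and> set b = w ` {v. 0 < code w v} \<and> descents w b"
proof -
  have w: "w (inv w x) = x" "inv w (w x) = x" for x
    using fin_perm_bij[OF assms] by (auto simp: bij_is_inj bij_is_surj surj_f_inv_f inv_f_f)
  obtain N where "\<forall>x\<in>w ` {v. 0 < code w v}. x < N"
    using finite_code_pos[OF assms] by (meson finite_imageI finite_nat_set_iff_bounded)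
  then have N: "x < N" if "0 < code w (inv w x)" for x
    using that w(1) by (metis (mono_tags, lifting) imageI mem_Collect_eq)
  have "\<exists>b. sorted_wrt (>) b \<and> set b = {x. t \<le> x \<and> 0 < code w (inv w x)} \<and> descents w b \<and>
      code (act w b) (inv (act w b) t) = 0" if "t \<le> N" for t
    using that
  proof (induction t rule: inc_induct)
    case base
    have "{x. N \<le> x \<and> 0 < code w (inv w x)} = {}"
      using N by force
    moreover have "code w (inv w N) = 0"
      using N by blast
    ultimately show ?case
      by (intro exI[of _ "[]"]) simp
  next
    case (step t)
    then obtain b where b: "sorted_wrt (>) b" "set b = {x. Suc t \<le> x \<and> 0 < code w (inv w x)}"
      "descents w b" "code (act w b) (inv (act w b) (Suc t)) = 0" by blast
    define w' where "w' = act w b"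
    have fin: "fin_perm w'" and bij: "bij w'"
      using fin_perm_act[OF assms b(3)] by (auto simp: w'_def fin_perm_bij)
    have w': "w' (inv w' x) = x" "inv w' (w' x) = x" for x
      using bij by (auto simp: bij_is_inj bij_is_surj surj_f_inv_f inv_f_f)
    have t: "inv w' t = inv w t"
      unfolding w'_def using assms b(2,3) by (intro inv_act_less) auto
    have code_t: "code w' (inv w t) = code w (inv w t)"
      using code_act[OF assms b(3,1), of "inv w t"] b(2) w(1) by (auto simp: w'_def)
    have le_iff: "t \<le> x \<longleftrightarrow> x = t \<or> Suc t \<le> x" for x
      by auto
    show ?case
    proof (cases "code w (inv w t) = 0")
      case True
      then have "{x. t \<le> x \<and> 0 < code w (inv w x)} = {x. Suc t \<le> x \<and> 0 < code w (inv w x)}"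
        using le_iff by (intro Collect_cong) (metis less_irrefl)
      moreover have "code (act w b) (inv (act w b) t) = 0"
        using True t code_t by (simp add: w'_def)
      ultimately show ?thesis
        using b(1-3) by (intro exI[of _ b]) simp
    next
      case False
      then have "0 < code w' (inv w' t)"
        using code_t t by simp
      then obtain u' where u': "u' < inv w' t" "t < w' u'"
        unfolding code_pos_iff w'(1) by blast
      \<comment> \<open>Otherwise \<open>Suc t\<close> would stand to the right of \<open>t\<close>,
        and the larger value at \<open>u'\<close>, which is then not \<open>Suc t\<close>, would
        also precede \<open>Suc t\<close>, against its code being 0.\<close>
      have descent: "left_descent w' t"
      proof (rule ccontr)
        assume "\<not> left_descent w' t"
        then have "inv w' t < inv w' (Suc t)"
          unfolding left_descent_def by (metis w'(1) n_not_Suc_n linorder_neqE_nat)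
        moreover have "w' u' \<noteq> Suc t"
          using u' calculation w'(2) by (metis order.asym)
        ultimately have "0 < code w' (inv w' (Suc t))"
          unfolding code_pos_iff w'(1) using u' by (intro exI[of _ u']) auto
        then show False
          using b(4) by (simp add: w'_def)
      qed
      \<comment> \<open>The value 0 sits at position 0 with nothing to its left, so the letter 0,
        which is no generator, never arises.\<close>
      have "t \<noteq> 0"
        using u'(1) fin_perm_0[OF fin] w'(2) by (metis not_less0)
      have "{x. t \<le> x \<and> 0 < code w (inv w x)} =
          insert t {x. Suc t \<le> x \<and> 0 < code w (inv w x)}"
        using False le_iff by (intro set_eqI) (metis (lifting) insert_iff mem_Collect_eq neq0_conv)
      moreover have "sorted_wrt (>) (b @ [t])"
        using b(1,2) by (auto simp: sorted_wrt_append)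
      moreover have "descents w (b @ [t])"
        using b(3) descent \<open>t \<noteq> 0\<close> by (auto simp: w'_def)
      \<comment> \<open>The letter \<open>t\<close> moves the entry of code 0 from the value
        \<open>Suc t\<close> to \<open>t\<close> without changing its code; this restores the
        invariant.\<close>
      moreover have "inv (smul t w') t = inv w' (Suc t)"
        using inv_smul[OF bij] by (simp add: simple_apply)
      then have "code (smul t w') (inv (smul t w') t) = 0"
        using code_smul[OF fin descent, of "inv w' (Suc t)"] b(4) by (simp add: w'_def)
      ultimately show ?thesis
        using b(2) by (intro exI[of _ "b @ [t]"]) (auto simp: w'_def)
    qed
  qed
  from this[of 0] obtain b where b: "sorted_wrt (>) b" "set b = {x. 0 < code w (inv w x)}"
    "descents w b" by auto
  moreover have "{x. 0 < code w (inv w x)} = w ` {v. 0 < code w v}"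
    using w by (auto simp: image_iff) metis
  ultimately show ?thesis by auto
qed

text \<open>An entry loses at most one per block and at most its code altogether, hence at most
  \<open>min (code w v) k\<close> in the first \<open>k\<close> blocks.\<close>

lemma sum_list_take_blocks_le:
  assumes "fin_perm w" "descents w a" "blocks (>) \<alpha> a"
    and "finite V" "{v. 0 < code w v} \<subseteq> V"
  shows "sum_list (take k \<alpha>) \<le> (\<Sum>v\<in>V. min (code w v) k)"
  using assms
proof (induction \<alpha> arbitrary: w a k)
  case (Cons l \<alpha>)
  show ?case
  proof (cases k)
    case (Suc k')
    obtain b c where a: "a = b @ c" "length b = l" "sorted_wrt (>) b" "blocks (>) \<alpha> c"
      using Cons.prems by (auto simp: blocks_Cons)
    have desc: "descents w b" "descents (act w b) c"
      using Cons.prems a by auto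
    have fin: "fin_perm (act w b)"
      using Cons.prems desc fin_perm_act by blast
    note code = code_act[OF Cons.prems(1) desc(1) a(3)]
    have "{v. 0 < code (act w b) v} \<subseteq> V"
      using Cons.prems(5) code by (auto simp: subset_iff) (metis add_gr_0)
    then have IH: "sum_list (take k' \<alpha>) \<le> (\<Sum>v\<in>V. min (code (act w b) v) k')"
      using Cons.IH[OF fin desc(2) a(4)] Cons.prems(4) by blast
    have "inj_on (inv w) (set b)"
      using fin_perm_bij[OF Cons.prems(1)] by (metis bij_imp_bij_inv bij_is_inj inj_on_subset subset_UNIV)
    have w: "w (inv w x) = x" "inv w (w x) = x" for x
      using fin_perm_bij[OF Cons.prems(1)]
      by (auto simp: bij_is_inj bij_is_surj surj_f_inv_f inv_f_f)
    have "distinct b"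
      using a(3) by (auto simp: distinct_conv_nth sorted_wrt_iff_nth_less nat_neq_iff)
    \<comment> \<open>The letters of the block are distinct values of \<open>w\<close>, so its
      length is the number of positions it lowers.\<close>
    then have "l = card (inv w ` set b)"
      using a(2) \<open>inj_on (inv w) (set b)\<close> by (simp add: card_image distinct_card)
    also have "inv w ` set b = {v \<in> V. w v \<in> set b}"
    proof -
      have "v \<in> V" if "w v \<in> set b" for v
        using code[of v] that Cons.prems(5) by auto
      then show ?thesis
        using w by (auto simp: image_iff) metis
    qed
    also have "card \<dots> = (\<Sum>v\<in>V. if w v \<in> set b then 1 else 0)"
      using Cons.prems(4) by (simp add: sum.If_cases Int_def)
    finally have "sum_list (take k (l # \<alpha>)) \<le>
        (\<Sum>v\<in>V. (if w v \<in> set b then 1 else 0) + min (code (act w b) v) k')"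
      using IH Suc by (simp add: sum.distrib)
    also have "\<dots> \<le> (\<Sum>v\<in>V. min (code w v) k)"
    proof (rule sum_mono)
      fix v
      show "(if w v \<in> set b then 1 else 0) + min (code (act w b) v) k' \<le> min (code w v) k"
        using code[of v] Suc by (auto split: if_splits)
    qed
    finally show ?thesis .
  qed simp
qed simp

text \<open>Removing the first column lowers each positive row by one; truncated subtraction leaves
  the empty rows alone. A maximal decreasing block does the same to a code.\<close>

lemma conjugate_Suc:
  "conjugate V f (Suc K) = card {v \<in> V. 0 < f v} # conjugate V (\<lambda>v. f v - 1) K"
  unfolding conjugate_def
  by (simp add: upt_conv_Cons map_Suc_upt[symmetric] less_diff_conv del: upt_Suc)

text \<open>The first block has as many letters as there are positive codes, so it must lower each
  of them once. This forces its letters and, as it decreases, their order; what remains has the code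
  with the first column removed.\<close>

lemma exists1_conjugate_blocks:
  assumes "fin_perm w" "finite V" "{v. 0 < code w v} \<subseteq> V" "\<And>v. code w v \<le> K"
  shows "\<exists>!a. descents w a \<and> act w a = id \<and> blocks (>) (conjugate V (code w) K) a"
  using assms
proof (induction K arbitrary: w)
  case 0
  then have "card (inversions w) = 0"
    using card_inversions[of V w] by simp
  then have "w = id"
    using fin_perm_no_inversions finite_inversions 0 by simp
  then show ?case
    by (intro ex1I[of _ "[]"]) (auto simp: conjugate_def)
next
  case (Suc K)
  obtain b where b: "sorted_wrt (>) b" "set b = w ` {v. 0 < code w v}" "descents w b"
    using exists_maximal_decreasing_block[OF Suc.prems(1)] by blast
  have inj: "inj w"
    using Suc.prems(1) fin_perm_bij bij_is_inj by blast
  have pos: "{v \<in> V. 0 < code w v} = {v. 0 < code w v}"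
    using Suc.prems(3) by auto
  have distinct: "distinct c" if "sorted_wrt (>) c" for c :: "nat list"
    using that by (auto simp: distinct_conv_nth sorted_wrt_iff_nth_less nat_neq_iff)
  have card: "card (w ` {v. 0 < code w v}) = card {v. 0 < code w v}"
    using inj by (auto intro: card_image inj_on_subset)
  have length: "length b = card {v. 0 < code w v}"
    using b(1,2) card distinct distinct_card by metis
  \<comment> \<open>Each letter of \<open>c\<close> lowers the code of the entry whose value it is,
    so the letters lie in the set of values with positive code, and the length makes them exhaust
    it.\<close>
  have block: "c = b"
    if c: "sorted_wrt (>) c" "length c = card {v. 0 < code w v}" "descents w c" for c
  proof -
    have "set c \<subseteq> w ` {v. 0 < code w v}"
    proof
      fix x assume "x \<in> set c"
      moreover have "w (inv w x) = x"
        using fin_perm_bij[OF Suc.prems(1)] by (simp add: bij_is_surj surj_f_inv_f)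
      ultimately show "x \<in> w ` {v. 0 < code w v}"
        using code_act[OF Suc.prems(1) c(3,1), of "inv w x"] by (intro image_eqI[of _ _ "inv w x"]) auto
    qed
    then have "set c = set b"
      using b(2) c card distinct distinct_card finite_code_pos[OF Suc.prems(1)]
      by (metis card_subset_eq finite_imageI)
    moreover have "sorted (rev x)" if "sorted_wrt (>) x" for x :: "nat list"
      using that by (auto simp: sorted_wrt_rev intro: sorted_wrt_mono_rel[of _ "(>)"])
    ultimately have "rev c = rev b"
      using b(1) c(1) distinct by (intro sorted_distinct_set_unique) auto
    then show ?thesis by simp
  qed
  define w' where "w' = act w b"
  have "code w' v = code w v - 1" for v
  proof -
    have "w v \<in> set b \<longleftrightarrow> 0 < code w v"
      using b(2) inj by (auto dest: injD)
    then show ?thesis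
      using code_act[OF Suc.prems(1) b(3,1), of v] by (auto simp: w'_def split: if_splits)
  qed
  then have code': "code w' = (\<lambda>v. code w v - 1)"
    by auto
  have fin: "fin_perm w'"
    using fin_perm_act Suc.prems(1) b(3) by (simp add: w'_def)
  have "{v. 0 < code w' v} \<subseteq> V"
    using Suc.prems(3) by (auto simp: code')
  moreover have "code w' v \<le> K" for v
    using Suc.prems(4)[of v] by (simp add: code')
  ultimately have IH: "\<exists>!a. descents w' a \<and> act w' a = id \<and> blocks (>) (conjugate V (code w') K) a"
    using Suc.IH[OF fin Suc.prems(2)] by blast
  then obtain a where a: "descents w' a" "act w' a = id" "blocks (>) (conjugate V (code w') K) a"
    by blast
  show ?case
  proof (rule ex1I[of _ "b @ a"])
    show "descents w (b @ a) \<and> act w (b @ a) = id \<and>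
        blocks (>) (conjugate V (code w) (Suc K)) (b @ a)"
      using a b length by (auto simp: w'_def code'[unfolded w'_def] conjugate_Suc pos blocks_Cons)
  next
    fix x
    assume x: "descents w x \<and> act w x = id \<and> blocks (>) (conjugate V (code w) (Suc K)) x"
    then obtain c d where "x = c @ d" "length c = card {v. 0 < code w v}" "sorted_wrt (>) c"
      "blocks (>) (conjugate V (code w') K) d"
      by (auto simp: conjugate_Suc pos blocks_Cons code')
    moreover from this have "c = b"
      using x block by auto
    ultimately show "x = b @ a"
      using x a IH by (auto simp: w'_def)
  qed
qed

section \<open>Coxeter length and the set of reduced words\<close>

lemma code_le_card_inversions:
  assumes "fin_perm w"
  shows "code w v \<le> card (inversions w)"
proof (cases "code w v = 0")
  case False
  then show ?thesis
    unfolding card_inversions[OF finite_code_pos[OF assms] order_refl]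
    using finite_code_pos[OF assms] by (intro member_le_sum) auto
qed simp

lemma descents_act_id:
  assumes "fin_perm w" "descents w a" "act w a = id"
  shows "length a = card (inversions w)" "a \<in> words_of w"
  using card_inversions_act[OF assms(1,2)] assms(3) act_eq_id_iff[of w a] descents_letters[OF assms(2)]
  by (auto simp: words_of_def)

text \<open>The word built from the code attains the number of inversions as its length. Each letter
  changes that number by one, so no shorter word exists.\<close>

lemma coxeter_length_eq:
  assumes "fin_perm w"
  shows "coxeter_length w = card (inversions w)"
  unfolding coxeter_length_def
proof (rule Least_equality)
  obtain a where a: "descents w a" "act w a = id"
    using exists1_conjugate_blocks[OF assms finite_code_pos[OF assms] order_refl
        code_le_card_inversions[OF assms]] by blast
  then show "\<exists>a\<in>words_of w. length a = card (inversions w)"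
    using descents_act_id[OF assms] by blast
next
  fix k
  assume "\<exists>a\<in>words_of w. length a = k"
  then show "card (inversions w) \<le> k"
    using card_inversions_word_perm by (auto simp: words_of_def)
qed

lemma reduced_words_eq:
  assumes "fin_perm w"
  shows "reduced_words w = {a. descents w a \<and> act w a = id}"
proof (intro set_eqI iffI)
  fix a
  assume "a \<in> reduced_words w"
  then show "a \<in> {a. descents w a \<and> act w a = id}"
    using descents_shortest[of a] coxeter_length_eq[OF assms]
    by (auto simp: reduced_words_def words_of_def act_eq_id_iff)
next
  fix a
  assume "a \<in> {a. descents w a \<and> act w a = id}"
  then show "a \<in> reduced_words w"
    using descents_act_id[OF assms, of a] coxeter_length_eq[OF assms]
    by (simp add: reduced_words_def)
qed

text \<open>Letters carry no a priori bound, but a left descent is the value of an entry with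
  positive code, which leaves finitely many choices at each step.\<close>

lemma finite_descents_length:
  "fin_perm w \<Longrightarrow> finite {a. descents w a \<and> length a = l}"
proof (induction l arbitrary: w)
  case (Suc l)
  define B where "B = {b \<in> w ` {v. 0 < code w v}. 1 \<le> b}"
  have "b \<in> w ` {v. 0 < code w v}" if "left_descent w b" for b
  proof -
    have "w (inv w b) = b"
      using fin_perm_bij[OF Suc.prems] by (simp add: bij_is_surj surj_f_inv_f)
    then show ?thesis
      using code_smul[OF Suc.prems that, of "inv w b"] by (intro image_eqI[of _ _ "inv w b"]) auto
  qed
  then have B: "b \<in> B" if "left_descent w b" "1 \<le> b" for b
    using that by (simp add: B_def)
  have "{a. descents w a \<and> length a = Suc l} \<subseteq>
      (\<Union>b\<in>B. (#) b ` {a. descents (smul b w) a \<and> length a = l})"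
  proof
    fix a assume "a \<in> {a. descents w a \<and> length a = Suc l}"
    then obtain b c where "a = b # c" "length c = l" "1 \<le> b" "left_descent w b" "descents (smul b w) c"
      by (auto simp: length_Suc_conv)
    then show "a \<in> (\<Union>b\<in>B. (#) b ` {a. descents (smul b w) a \<and> length a = l})"
      using B[of b] by blast
  qed
  moreover have "finite B"
    using finite_code_pos[OF Suc.prems] by (simp add: B_def)
  then have "finite (\<Union>b\<in>B. (#) b ` {a. descents (smul b w) a \<and> length a = l})"
    using Suc by (intro finite_UN_I finite_imageI) (auto simp: B_def fin_perm_smul)
  ultimately show ?case
    by (rule finite_subset)
qed simp

lemma finite_reduced_words:
  assumes "fin_perm w"
  shows "finite (reduced_words w)"
proof (rule finite_subset)
  show "reduced_words w \<subseteq> {a. descents w a \<and> length a = coxeter_length w}"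
    using reduced_words_eq[OF assms] by (auto simp: reduced_words_def)
qed (rule finite_descents_length[OF assms])

section \<open>Reversed words and the inverse permutation\<close>

lemma word_perm_append: "word_perm (a @ b) = word_perm a \<circ> word_perm b"
  by (induction a) (auto simp: fun_eq_iff smul_apply)

lemma word_perm_rev:
  assumes "\<forall>i\<in>set a. 1 \<le> i"
  shows "word_perm (rev a) = inv (word_perm a)"
proof -
  have *: "word_perm b \<circ> word_perm (rev b) = id" for b
    by (induction b) (auto simp: fun_eq_iff smul_apply word_perm_append)
  show ?thesis
    using inv_unique_comp[OF *[of a]] *[of "rev a"] by simp
qed

text \<open>Reversal carries words of \<open>w\<close> to words of \<open>inv w\<close> and back, so
  the two minimal lengths agree.\<close>

lemma rev_in_reduced_words_inv:
  assumes "fin_perm w" "a \<in> reduced_words w"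
  shows "rev a \<in> reduced_words (inv w)"
proof -
  have words: "rev b \<in> words_of (inv v)" if "b \<in> words_of v" for b v
    using that word_perm_rev[of b] by (auto simp: words_of_def)
  have inv_inv: "inv (inv w) = w"
    using fin_perm_bij[OF assms(1)] by (rule inv_inv_eq)
  have "(\<exists>b\<in>words_of (inv w). length b = k) \<longleftrightarrow> (\<exists>b\<in>words_of w. length b = k)" for k
    using words[of _ w] words[of _ "inv w"] unfolding inv_inv by (metis length_rev)
  then have "coxeter_length (inv w) = coxeter_length w"
    by (simp add: coxeter_length_def)
  then show ?thesis
    using assms(2) words by (simp add: reduced_words_def)
qed

lemma fin_perm_inv: "fin_perm w \<Longrightarrow> fin_perm (inv w)"
  unfolding fin_perm_def by (blast intro: permutes_inv)

lemma rev_in_reduced_words_inv_iff: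
  assumes "fin_perm w"
  shows "rev a \<in> reduced_words (inv w) \<longleftrightarrow> a \<in> reduced_words w"
  using rev_in_reduced_words_inv[OF assms] rev_in_reduced_words_inv[OF fin_perm_inv[OF assms], of "rev a"]
    inv_inv_eq[OF fin_perm_bij[OF assms]] by auto

section \<open>Yamanouchi words\<close>

definition lattice_word :: "nat list \<Rightarrow> bool" where
  "lattice_word r \<longleftrightarrow> (\<forall>k i. count_list (take k r) (Suc i) \<le> count_list (take k r) i)"

text \<open>
  A Yamanouchi word of shape \<open>\<mu>\<close> lists the rows, numbered from 0, in which a standard tableau
  of shape \<open>\<mu>\<close> grows.
\<close>

definition yamanouchi :: "nat list \<Rightarrow> nat list set" where
  "yamanouchi \<mu> = {r. lattice_word r \<and> (\<forall>i. count_list r i = (if i < length \<mu> then \<mu> ! i else 0))}"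

lemma lattice_word_prefix: "lattice_word (p @ q) \<Longrightarrow> lattice_word p"
  unfolding lattice_word_def
proof (intro allI)
  fix k i
  assume "\<forall>k i. count_list (take k (p @ q)) (Suc i) \<le> count_list (take k (p @ q)) i"
  from this[rule_format, of "min k (length p)" i]
  show "count_list (take k p) (Suc i) \<le> count_list (take k p) i"
    by (simp add: min_def split: if_splits)
qed

lemma lattice_word_count: "lattice_word r \<Longrightarrow> count_list r (Suc i) \<le> count_list r i"
  unfolding lattice_word_def by (metis order_refl take_all)

lemma lattice_word_Nil [simp]: "lattice_word []"
  by (simp add: lattice_word_def)

lemma lattice_word_snoc:
  assumes "lattice_word r" "\<And>i. count_list (r @ [x]) (Suc i) \<le> count_list (r @ [x]) i"
  shows "lattice_word (r @ [x])"
  unfolding lattice_word_def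
proof (intro allI)
  fix k i
  show "count_list (take k (r @ [x])) (Suc i) \<le> count_list (take k (r @ [x])) i"
  proof (cases "k \<le> length r")
    case True
    then show ?thesis using assms(1) by (simp add: lattice_word_def)
  next
    case False
    then have "take k (r @ [x]) = r @ [x]" by simp
    then show ?thesis using assms(2)[of i] by metis
  qed
qed

lemma yamanouchi_letters:
  assumes "r \<in> yamanouchi \<mu>"
  shows "set r \<subseteq> {..<length \<mu>}"
proof
  fix i assume "i \<in> set r"
  then have "count_list r i \<noteq> 0"
    by (simp add: count_list_0_iff)
  then show "i \<in> {..<length \<mu>}"
    using assms by (auto simp: yamanouchi_def split: if_splits)
qed

lemma length_yamanouchi:
  assumes "r \<in> yamanouchi \<mu>"
  shows "length r = sum_list \<mu>"
proof -
  have "length r = (\<Sum>i<length \<mu>. count_list r i)"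
    using yamanouchi_letters[OF assms] by (intro sum_count_set[symmetric]) auto
  also have "\<dots> = (\<Sum>i<length \<mu>. \<mu> ! i)"
    using assms by (auto simp: yamanouchi_def)
  finally show ?thesis
    by (simp add: sum_list_sum_nth atLeast0LessThan)
qed

lemma finite_yamanouchi: "finite (yamanouchi \<mu>)"
proof (rule finite_subset)
  show "yamanouchi \<mu> \<subseteq> {r. set r \<subseteq> {..<length \<mu>} \<and> length r = sum_list \<mu>}"
    using yamanouchi_letters length_yamanouchi by blast
qed (simp add: finite_lists_length_eq)

section \<open>Yamanouchi words in decreasing blocks\<close>

text \<open>The largest letter of a block comes first, and if it is positive its predecessor must
  already occur in an earlier block. Each block thus raises the bound on the letters by at most
  one.\<close>

lemma lattice_word_decreasing_blocks:
  assumes "lattice_word (concat bs)" "\<forall>b\<in>set bs. sorted_wrt (\<ge>) b"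
  shows "set (concat bs) \<subseteq> {..<length bs}"
  using assms
proof (induction bs rule: rev_induct)
  case (snoc b bs)
  have IH: "set (concat bs) \<subseteq> {..<length bs}"
    using snoc lattice_word_prefix[of "concat bs" b] by auto
  have "x < Suc (length bs)" if "x \<in> set b" for x
  proof (cases b)
    case (Cons y c)
    have "y \<le> length bs"
    proof (cases y)
      case (Suc z)
      have "lattice_word (concat bs @ [y])"
        using snoc.prems(1) lattice_word_prefix[of "concat bs @ [y]" c] Cons by simp
      from lattice_word_count[OF this, of z] have "count_list (concat bs) z \<noteq> 0"
        using Suc by (simp add: count_list_append)
      then have "z \<in> set (concat bs)"
        by (simp add: count_list_0_iff)
      then show ?thesis
        using IH Suc by auto
    qed simp
    moreover have "x \<le> y"
      using snoc.prems(2) that Cons by auto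
    ultimately show ?thesis by simp
  qed (use that in simp)
  then show ?case
    using IH by auto
qed simp

lemma sum_list_take_eq_sum: "sum_list (take k xs) = (\<Sum>i<k. if i < length xs then xs ! i else (0 :: nat))"
proof -
  have "sum_list (take k xs) = (\<Sum>i<min k (length xs). xs ! i)"
    by (simp add: sum_list_sum_nth atLeast0LessThan min.commute)
  also have "{..<min k (length xs)} = {i \<in> {..<k}. i < length xs}"
    by auto
  finally show ?thesis
    by (simp add: sum.inter_filter[symmetric])
qed

text \<open>The first \<open>k\<close> blocks use only the letters below \<open>k\<close>, and these
  occur as often as the first \<open>k\<close> rows have cells.\<close>

lemma yamanouchi_decreasing_blocks_le:
  assumes "r \<in> yamanouchi \<mu>" "blocks (\<ge>) \<alpha> r"
  shows "sum_list (take k \<alpha>) \<le> sum_list (take k \<mu>)"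
proof -
  obtain bs where bs: "concat bs = r" "map length bs = \<alpha>" "\<forall>b\<in>set bs. sorted_wrt (\<ge>) b"
    using assms(2) by (auto simp: blocks_def)
  define p q where "p = concat (take k bs)" and "q = concat (drop k bs)"
  have r: "r = p @ q"
    unfolding p_def q_def bs(1)[symmetric] by (metis append_take_drop_id concat_append)
  then have "lattice_word p"
    using assms(1) lattice_word_prefix by (auto simp: yamanouchi_def)
  then have "set p \<subseteq> {..<length (take k bs)}"
    unfolding p_def using bs(3) by (intro lattice_word_decreasing_blocks) (auto dest: in_set_takeD)
  then have "set p \<subseteq> {..<k}"
    by auto
  then have "length p = (\<Sum>i<k. count_list p i)"
    by (intro sum_count_set[symmetric]) auto
  also have "\<dots> \<le> (\<Sum>i<k. count_list r i)"
    by (intro sum_mono) (simp add: r count_list_append)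
  also have "\<dots> = sum_list (take k \<mu>)"
    using assms(1) by (simp add: sum_list_take_eq_sum yamanouchi_def)
  also have "length p = sum_list (take k \<alpha>)"
    unfolding p_def bs(2)[symmetric] by (simp add: length_concat take_map)
  finally show ?thesis .
qed

lemma count_list_replicate: "count_list (replicate m x) y = (if x = y then m else 0)"
  by (induction m) auto

lemma lattice_word_append_replicate:
  assumes "lattice_word r" "x = 0 \<or> count_list r x + m \<le> count_list r (x - 1)"
  shows "lattice_word (r @ replicate m x)"
  using assms(2)
proof (induction m)
  case 0
  then show ?case using assms(1) by simp
next
  case (Suc m)
  have "lattice_word ((r @ replicate m x) @ [x])"
  proof (rule lattice_word_snoc)
    show "lattice_word (r @ replicate m x)"
      using Suc by auto
    show "count_list ((r @ replicate m x) @ [x]) (Suc i) \<le> count_list ((r @ replicate m x) @ [x]) i" for i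
      using lattice_word_count[OF assms(1), of i] Suc.prems
      by (auto simp: count_list_append count_list_replicate)
  qed
  then show ?case
    by (simp add: replicate_append_same)
qed

text \<open>The witness fills the diagram row by row. Each block is constant, hence weakly
  decreasing.\<close>

lemma exists_yamanouchi_decreasing:
  assumes "sorted_wrt (\<ge>) \<mu>"
  shows "\<exists>r\<in>yamanouchi \<mu>. blocks (\<ge>) \<mu> r"
  using assms
proof (induction \<mu> rule: rev_induct)
  case Nil
  then show ?case by (auto simp: yamanouchi_def)
next
  case (snoc m \<mu>)
  then obtain r where r: "r \<in> yamanouchi \<mu>" "blocks (\<ge>) \<mu> r"
    by (auto simp: sorted_wrt_append)
  have count: "count_list r i = (if i < length \<mu> then \<mu> ! i else 0)" for i
    using r(1) by (simp add: yamanouchi_def)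
  have "length \<mu> = 0 \<or> count_list r (length \<mu>) + m \<le> count_list r (length \<mu> - 1)"
  proof (cases "\<mu> = []")
    case False
    then have "length \<mu> - 1 < length \<mu>"
      by simp
    then have "m \<le> \<mu> ! (length \<mu> - 1)"
      using snoc.prems nth_mem by (auto simp: sorted_wrt_append)
    then show ?thesis
      using \<open>length \<mu> - 1 < length \<mu>\<close> by (simp only: count) simp
  qed simp
  then have "lattice_word (r @ replicate m (length \<mu>))"
    using r(1) by (intro lattice_word_append_replicate) (simp_all add: yamanouchi_def)
  then have "r @ replicate m (length \<mu>) \<in> yamanouchi (\<mu> @ [m])"
    by (auto simp: yamanouchi_def count_list_append count_list_replicate count nth_append)
  moreover have "blocks (\<ge>) (\<mu> @ [m]) (r @ replicate m (length \<mu>))"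
    using blocks_snoc[OF r(2), of "replicate m (length \<mu>)"]
    by (simp add: sorted_wrt_iff_nth_less)
  ultimately show ?case by blast
qed

section \<open>Yamanouchi words in increasing blocks\<close>

lemma count_list_concat: "count_list (concat bs) x = sum_list (map (\<lambda>b. count_list b x) bs)"
  by (induction bs) (auto simp: count_list_append)

lemma count_list_distinct: "distinct b \<Longrightarrow> count_list b x \<le> 1"
  by (induction b) (auto simp: count_list_0_iff)

text \<open>A strictly increasing block contains each letter at most once, so the letter
  \<open>i\<close> occurs at most \<open>min (\<mu> ! i) k\<close> times in \<open>k\<close> blocks.
  Because of \<open>rev\<close>, the first entries of \<open>\<alpha>\<close> are the lengths of the
  last blocks, as reversal of words requires.\<close>

lemma yamanouchi_increasing_blocks_le:
  assumes "r \<in> yamanouchi \<mu>" "blocks (<) (rev \<alpha>) r"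
  shows "sum_list (take k \<alpha>) \<le> (\<Sum>i<length \<mu>. min (\<mu> ! i) k)"
proof -
  obtain bs where bs: "concat bs = r" "map length bs = rev \<alpha>" "\<forall>b\<in>set bs. sorted_wrt (<) b"
    using assms(2) by (auto simp: blocks_def)
  have \<alpha>: "\<alpha> = map length (rev bs)"
    using bs(2) by (metis rev_map rev_rev_ident)
  define q where "q = concat (take k (rev bs))"
  have count: "count_list q i \<le> min (count_list r i) k" for i
  proof -
    have q: "count_list q i = sum_list (map (\<lambda>b. count_list b i) (take k (rev bs)))"
      by (simp add: q_def count_list_concat)
    have "count_list b i \<le> 1" if "b \<in> set (take k (rev bs))" for b
    proof -
      have "distinct b"
        using bs(3) that by (auto simp: strict_sorted_iff dest!: in_set_takeD)
      then show ?thesis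
        by (rule count_list_distinct)
    qed
    then have "count_list q i \<le> sum_list (map (\<lambda>b. 1) (take k (rev bs)))"
      unfolding q by (intro sum_list_mono)
    then have "count_list q i \<le> k"
      by (simp add: sum_list_triv)
    moreover have "count_list r i = sum_list (map (\<lambda>b. count_list b i) (take k (rev bs) @ drop k (rev bs)))"
      by (simp add: bs(1)[symmetric] count_list_concat rev_map[symmetric] sum_list.rev)
    then have "count_list q i \<le> count_list r i"
      unfolding q map_append sum_list_append by simp
    ultimately show ?thesis by simp
  qed
  have "set q \<subseteq> set r"
    unfolding q_def bs(1)[symmetric] by (force dest: in_set_takeD)
  then have "length q = (\<Sum>i<length \<mu>. count_list q i)"
    using yamanouchi_letters[OF assms(1)] by (intro sum_count_set[symmetric]) auto
  also have "\<dots> \<le> (\<Sum>i<length \<mu>. min (\<mu> ! i) k)"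
  proof (rule sum_mono)
    fix i assume "i \<in> {..<length \<mu>}"
    then show "count_list q i \<le> min (\<mu> ! i) k"
      using count[of i] assms(1) by (simp add: yamanouchi_def)
  qed
  also have "length q = sum_list (take k \<alpha>)"
    by (simp add: q_def \<alpha> length_concat take_map)
  finally show ?thesis .
qed

text \<open>Within the appended run a prefix gains \<open>Suc i\<close> only after it has gained
  \<open>i\<close>.\<close>

lemma lattice_word_append_upt:
  assumes "lattice_word r"
  shows "lattice_word (r @ [0..<h])"
proof (induction h)
  case 0
  then show ?case using assms by simp
next
  case (Suc h)
  have upt: "count_list [0..<k] y = (if y < k then 1 else 0)" for k y
    by (induction k) (auto simp: count_list_append)
  have "lattice_word ((r @ [0..<h]) @ [h])"
    using Suc
  proof (rule lattice_word_snoc)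
    show "count_list ((r @ [0..<h]) @ [h]) (Suc i) \<le> count_list ((r @ [0..<h]) @ [h]) i" for i
      using lattice_word_count[OF assms, of i] by (auto simp: count_list_append upt)
  qed
  then show ?case by simp
qed

text \<open>Both sides say that the cell in row \<open>i\<close> and column \<open>j\<close> belongs
  to the diagram: the rows that reach beyond column \<open>j\<close> form an initial
  segment.\<close>

lemma less_card_partition_iff:
  assumes "sorted_wrt (\<ge>) (\<nu> :: nat list)"
  shows "i < card {v \<in> {..<length \<nu>}. j < \<nu> ! v} \<longleftrightarrow> i < length \<nu> \<and> j < \<nu> ! i"
proof -
  define S where "S = {v \<in> {..<length \<nu>}. j < \<nu> ! v}"
  have mono: "\<nu> ! v \<le> \<nu> ! u" if "u \<le> v" "v < length \<nu>" for u v
    using assms that by (cases "u = v") (auto simp: sorted_wrt_iff_nth_less)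
  show ?thesis
  proof (cases "i < length \<nu> \<and> j < \<nu> ! i")
    case True
    then have "{..i} \<subseteq> S"
      using mono by (auto simp: S_def intro: less_le_trans)
    then have "card {..i} \<le> card S"
      by (intro card_mono) (auto simp: S_def)
    then show ?thesis
      using True by (simp add: S_def)
  next
    case False
    have "v < i" if "v \<in> S" for v
      using that False mono[of i v] by (cases "v < i") (auto simp: S_def)
    then have "card S \<le> card {..<i}"
      by (intro card_mono) auto
    then show ?thesis
      using False by (auto simp: S_def)
  qed
qed

text \<open>The witness fills the diagram column by column, the last column first; a column of
  height h contributes the block \<open>[0..<h]\<close>.\<close>

lemma exists_yamanouchi_increasing:
  assumes "sorted_wrt (\<ge>) \<nu>" "\<forall>i<length \<nu>. \<nu> ! i \<le> K"
  shows "\<exists>r\<in>yamanouchi \<nu>. blocks (<) (rev (conjugate {..<length \<nu>} ((!) \<nu>) K)) r"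
proof -
  define hs where "hs = rev (conjugate {..<length \<nu>} ((!) \<nu>) K)"
  define r where "r = concat (map (\<lambda>h. [0..<h]) hs)"
  have "lattice_word (concat (map (\<lambda>h. [0..<h]) xs))" for xs
    by (induction xs rule: rev_induct) (auto intro: lattice_word_append_upt)
  then have "lattice_word r"
    by (simp add: r_def)
  have "count_list [0..<h] i = (if i < h then 1 else 0)" for h i
    by (induction h) (auto simp: count_list_append)
  then have "count_list r i = sum_list (map (\<lambda>h. if i < h then 1 else 0) hs)" for i
    by (simp add: r_def count_list_concat comp_def)
  moreover have "sum_list (map (\<lambda>h. if i < h then 1 else (0 :: nat)) hs) = sum_list (map (\<lambda>j. if i < card {v \<in> {..<length \<nu>}. j < \<nu> ! v} then 1 else 0) [0..<K])" for i
    by (simp add: hs_def conjugate_def rev_map[symmetric] comp_def sum_list.rev)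
  moreover have "sum_list (map (\<lambda>j. if i < card {v \<in> {..<length \<nu>}. j < \<nu> ! v} then 1 else (0 :: nat)) [0..<K])
      = (\<Sum>j<K. if i < length \<nu> \<and> j < \<nu> ! i then 1 else 0)" for i
    unfolding less_card_partition_iff[OF assms(1)]
    by (simp add: interv_sum_list_conv_sum_set_nat atLeast0LessThan)
  ultimately have count: "count_list r i = (\<Sum>j<K. if i < length \<nu> \<and> j < \<nu> ! i then 1 else 0)" for i
    by presburger
  have "count_list r i = (if i < length \<nu> then \<nu> ! i else 0)" for i
  proof (cases "i < length \<nu>")
    case True
    then have "{..<K} \<inter> {j. j < \<nu> ! i} = {..<\<nu> ! i}"
      using assms(2) by auto
    then show ?thesis
      using True by (simp add: count sum.If_cases)
  qed (simp add: count)
  then have "r \<in> yamanouchi \<nu>"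
    using \<open>lattice_word r\<close> by (simp add: yamanouchi_def)
  moreover have "blocks (<) hs r"
    unfolding blocks_def r_def
    by (intro exI[of _ "map (\<lambda>h. [0..<h]) hs"]) (auto simp: comp_def)
  ultimately show ?thesis
    unfolding hs_def by blast
qed

section \<open>Tableaux as Yamanouchi words\<close>

text \<open>
  A cell of a tableau is recorded as the pair of its entry and its row. Reading the cells by
  increasing entry, and from the bottom row to the top one among equal entries, turns a
  semistandard tableau into a Yamanouchi word together with a compatible sequence.
\<close>

definition cell_le :: "nat \<times> nat \<Rightarrow> nat \<times> nat \<Rightarrow> bool" where
  "cell_le p q \<longleftrightarrow> fst p < fst q \<or> fst p = fst q \<and> snd q \<le> snd p"

lemma transp_cell_le: "transp cell_le"
  by (auto simp: transp_def cell_le_def)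

lemma compatible_seqs_iff_cells:
  assumes "length i = length r"
  shows "i \<in> compatible_seqs r \<longleftrightarrow> (\<forall>k\<in>set i. 1 \<le> k) \<and> sorted_wrt cell_le (zip i r)"
proof -
  have sorted: "sorted i \<longleftrightarrow> (\<forall>j. Suc j < length r \<longrightarrow> i ! j \<le> i ! Suc j)"
    using assms by (simp add: sorted_iff_nth_Suc)
  have cells: "sorted_wrt cell_le (zip i r) \<longleftrightarrow>
      (\<forall>j. Suc j < length r \<longrightarrow> cell_le (i ! j, r ! j) (i ! Suc j, r ! Suc j))"
    using assms by (subst sorted_wrt_iff_nth_Suc_transp[OF transp_cell_le]) auto
  have "cell_le (i ! j, r ! j) (i ! Suc j, r ! Suc j) \<longleftrightarrow>
      i ! j \<le> i ! Suc j \<and> (r ! j < r ! Suc j \<longrightarrow> i ! j < i ! Suc j)" for j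
    by (auto simp: cell_le_def)
  then show ?thesis
    unfolding compatible_seqs_def mem_Collect_eq sorted cells using assms by (simp only:) blast
qed

lemma sorted_cells_unique:
  assumes "mset z = mset z'" "sorted_wrt cell_le z" "sorted_wrt cell_le z'"
  shows "z = z'"
  using assms
proof (induction z arbitrary: z')
  case (Cons x z)
  from Cons.prems(1) obtain y y' where z': "z' = y # y'"
    by (cases z') auto
  have "set (x # z) = set (y # y')"
    using Cons.prems(1) unfolding z' by (rule mset_eq_setD)
  then have "x \<in> set (y # y')" "y \<in> set (x # z)"
    by (metis list.set_intros(1))+
  then have "x = y \<or> cell_le x y \<and> cell_le y x"
    using Cons.prems(2,3) z' by auto
  then have "x = y"
    by (auto simp: cell_le_def prod_eq_iff)
  then show ?case
    using Cons.IH[of y'] Cons.prems z' by simp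
qed simp

lemma exists_sorted_cells: "\<exists>z. mset z = mset zs \<and> sorted_wrt cell_le z"
proof (induction zs)
  case (Cons x zs)
  then obtain z where z: "mset z = mset zs" "sorted_wrt cell_le z"
    by auto
  define z' where "z' = filter (\<lambda>y. cell_le y x) z @ x # filter (\<lambda>y. \<not> cell_le y x) z"
  have after: "cell_le x y" if "\<not> cell_le y x" for y
    using that by (auto simp: cell_le_def)
  have before: "cell_le y y'" if "cell_le y x" "cell_le x y'" for y y'
    using transp_cell_le that by (rule transpD)
  have "sorted_wrt cell_le z'"
    by (simp add: z'_def sorted_wrt_append sorted_wrt_filter z(2)) (use after before in blast)
  moreover have "mset z' = mset (x # zs)"
    unfolding z'_def mset_append mset.simps mset_filter z(1)
    using multiset_partition[of "mset zs" "\<lambda>y. cell_le y x"] by (metis union_mset_add_mset_right)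
  ultimately show ?case by blast
qed simp

lemma count_list_map_snd: "count_list (map snd z) k = length (filter (\<lambda>p. snd p = k) z)"
  by (induction z) auto

lemma length_filter_mono: "(\<And>x. P x \<Longrightarrow> Q x) \<Longrightarrow> length (filter P xs) \<le> length (filter Q xs)"
  by (induction xs) (auto simp: le_SucI)

text \<open>The critical prefix ends at the last cell of row \<open>Suc k\<close> with entry at most
  \<open>e\<close>. Among equal entries lower rows are read first, so the cells of row
  \<open>k\<close> before it have entries below \<open>e\<close>.\<close>

lemma lattice_word_iff_cell_counts:
  assumes "sorted_wrt cell_le z"
  shows "lattice_word (map snd z) \<longleftrightarrow>
    (\<forall>k e. length (filter (\<lambda>p. snd p = Suc k \<and> fst p \<le> e) z) \<le>
       length (filter (\<lambda>p. snd p = k \<and> fst p < e) z))"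
proof (intro iffI allI)
  fix k e
  assume lattice: "lattice_word (map snd z)"
  show "length (filter (\<lambda>p. snd p = Suc k \<and> fst p \<le> e) z) \<le>
      length (filter (\<lambda>p. snd p = k \<and> fst p < e) z)"
  proof (cases "\<exists>p\<in>set z. snd p = Suc k \<and> fst p \<le> e")
    case True
    then obtain y x q where z: "z = y @ x # q" "snd x = Suc k" "fst x \<le> e"
      and q: "\<forall>p\<in>set q. \<not> (snd p = Suc k \<and> fst p \<le> e)"
      by (rule split_list_last_propE) blast
    have "filter (\<lambda>p. snd p = Suc k \<and> fst p \<le> e) q = []"
      using q by (simp add: filter_empty_conv)
    then have "length (filter (\<lambda>p. snd p = Suc k \<and> fst p \<le> e) z) =
        length (filter (\<lambda>p. snd p = Suc k \<and> fst p \<le> e) (y @ [x]))"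
      by (simp add: z(1))
    also have "\<dots> \<le> length (filter (\<lambda>p. snd p = Suc k) (y @ [x]))"
      by (rule length_filter_mono) simp
    also have "\<dots> \<le> length (filter (\<lambda>p. snd p = k) (y @ [x]))"
    proof -
      have "lattice_word (map snd (y @ [x]))"
        using lattice lattice_word_prefix[of "map snd (y @ [x])" "map snd q"] z(1) by simp
      from lattice_word_count[OF this, of k] show ?thesis
        by (simp only: count_list_map_snd)
    qed
    also have "\<dots> = length (filter (\<lambda>p. snd p = k) y)"
      using z(2) by simp
    also have "filter (\<lambda>p. snd p = k) y = filter (\<lambda>p. snd p = k \<and> fst p < e) y"
    proof (rule filter_cong)
      fix p assume "p \<in> set y"
      then have "cell_le p x"
        using assms z(1) by (simp add: sorted_wrt_append)
      then show "snd p = k \<longleftrightarrow> snd p = k \<and> fst p < e"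
        using z(2,3) by (auto simp: cell_le_def)
    qed simp
    also have "length \<dots> \<le> length (filter (\<lambda>p. snd p = k \<and> fst p < e) z)"
      by (simp add: z(1))
    finally show ?thesis .
  next
    case False
    then have "filter (\<lambda>p. snd p = Suc k \<and> fst p \<le> e) z = []"
      by (simp add: filter_empty_conv)
    then show ?thesis by simp
  qed
next
  assume counts: "\<forall>k e. length (filter (\<lambda>p. snd p = Suc k \<and> fst p \<le> e) z) \<le>
      length (filter (\<lambda>p. snd p = k \<and> fst p < e) z)"
  show "lattice_word (map snd z)"
    unfolding lattice_word_def
  proof (intro allI)
    fix j k
    define p s where "p = take j z" and "s = drop j z"
    have z: "z = p @ s"
      by (simp add: p_def s_def)
    have "length (filter (\<lambda>p. snd p = Suc k) p) \<le> length (filter (\<lambda>p. snd p = k) p)"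
    proof (cases p rule: rev_cases)
      case (snoc y x)
      have "filter (\<lambda>q. snd q = Suc k) p = filter (\<lambda>q. snd q = Suc k \<and> fst q \<le> fst x) p"
      proof (rule filter_cong)
        fix q assume "q \<in> set p"
        moreover have "sorted_wrt cell_le (y @ [x])"
          using assms snoc by (simp add: z sorted_wrt_append)
        ultimately have "q = x \<or> cell_le q x"
          using snoc by (auto simp: sorted_wrt_append)
        then show "snd q = Suc k \<longleftrightarrow> snd q = Suc k \<and> fst q \<le> fst x"
          by (auto simp: cell_le_def)
      qed simp
      also have "length \<dots> \<le> length (filter (\<lambda>q. snd q = Suc k \<and> fst q \<le> fst x) z)"
        by (simp add: z)
      also have "\<dots> \<le> length (filter (\<lambda>q. snd q = k \<and> fst q < fst x) z)"
        using counts by blast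
      \<comment> \<open>Cells after the prefix have entries at least \<open>fst x\<close>, so those
        of row \<open>k\<close> with a smaller entry all lie inside it.\<close>
      also have "filter (\<lambda>q. snd q = k \<and> fst q < fst x) s = []"
      proof -
        have "\<not> fst q < fst x" if "q \<in> set s" for q
        proof -
          have "x \<in> set p"
            using snoc by simp
          then have "cell_le x q"
            using assms that by (simp add: z sorted_wrt_append)
          then show ?thesis
            by (auto simp: cell_le_def)
        qed
        then show ?thesis
          by (auto simp: filter_empty_conv)
      qed
      then have "filter (\<lambda>q. snd q = k \<and> fst q < fst x) z = filter (\<lambda>q. snd q = k \<and> fst q < fst x) p"
        by (simp add: z)
      also have "length (filter (\<lambda>q. snd q = k \<and> fst q < fst x) p) \<le> length (filter (\<lambda>q. snd q = k) p)"
        by (rule length_filter_mono) simp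
      finally show ?thesis .
    qed simp
    then show "count_list (take j (map snd z)) (Suc k) \<le> count_list (take j (map snd z)) k"
      by (simp only: take_map count_list_map_snd p_def)
  qed
qed

text \<open>For \<open>e = ys ! j\<close> at least \<open>Suc j\<close> entries of \<open>ys\<close>
  are at most \<open>e\<close>, so as many entries of \<open>xs\<close> lie below \<open>e\<close>,
  among them \<open>xs ! j\<close> by sortedness.\<close>

lemma column_strict_iff_counts:
  assumes "sorted xs" "sorted (ys :: nat list)"
  shows "(\<forall>e. length (filter (\<lambda>y. y \<le> e) ys) \<le> length (filter (\<lambda>x. x < e) xs)) \<longleftrightarrow>
    length ys \<le> length xs \<and> (\<forall>j<length ys. xs ! j < ys ! j)"
proof
  assume counts: "\<forall>e. length (filter (\<lambda>y. y \<le> e) ys) \<le> length (filter (\<lambda>x. x < e) xs)"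
  have less: "j < length xs \<and> xs ! j < ys ! j" if j: "j < length ys" for j
  proof (rule ccontr)
    assume contra: "\<not> (j < length xs \<and> xs ! j < ys ! j)"
    have "{..j} \<subseteq> {i. i < length ys \<and> ys ! i \<le> ys ! j}"
      using j assms(2) by (auto intro: sorted_nth_mono)
    then have "card {..j} \<le> length (filter (\<lambda>y. y \<le> ys ! j) ys)"
      unfolding length_filter_conv_card by (intro card_mono) auto
    moreover have "i < j" if "i < length xs" "xs ! i < ys ! j" for i
    proof (rule ccontr)
      assume "\<not> i < j"
      then have "j < length xs" "xs ! j \<le> xs ! i"
        using that(1) assms(1) by (auto intro: sorted_nth_mono)
      then show False
        using contra that(2) by simp
    qed
    then have "length (filter (\<lambda>x. x < ys ! j) xs) \<le> card {..<j}"
      unfolding length_filter_conv_card by (intro card_mono) auto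
    ultimately show False
      using counts[rule_format, of "ys ! j"] by simp
  qed
  have "length ys \<le> length xs"
    using less[of "length xs"] by (rule_tac ccontr) auto
  then show "length ys \<le> length xs \<and> (\<forall>j<length ys. xs ! j < ys ! j)"
    using less by blast
next
  assume *: "length ys \<le> length xs \<and> (\<forall>j<length ys. xs ! j < ys ! j)"
  show "\<forall>e. length (filter (\<lambda>y. y \<le> e) ys) \<le> length (filter (\<lambda>x. x < e) xs)"
  proof
    fix e
    have "{i. i < length ys \<and> ys ! i \<le> e} \<subseteq> {i. i < length xs \<and> xs ! i < e}"
      using * by (auto intro: less_le_trans)
    then show "length (filter (\<lambda>y. y \<le> e) ys) \<le> length (filter (\<lambda>x. x < e) xs)"
      unfolding length_filter_conv_card by (intro card_mono) auto
  qed
qed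

definition rows_of_cells :: "nat \<Rightarrow> (nat \<times> nat) list \<Rightarrow> nat list list" where
  "rows_of_cells n z = map (\<lambda>k. map fst (filter (\<lambda>p. snd p = k) z)) [0..<n]"

lemma length_rows_of_cells [simp]: "length (rows_of_cells n z) = n"
  by (simp add: rows_of_cells_def)

lemma nth_rows_of_cells [simp]:
  "k < n \<Longrightarrow> rows_of_cells n z ! k = map fst (filter (\<lambda>p. snd p = k) z)"
  by (simp add: rows_of_cells_def)

lemma sorted_row_of_cells:
  assumes "sorted_wrt cell_le z"
  shows "sorted (map fst (filter (\<lambda>p. snd p = k) z))"
proof -
  have "sorted_wrt cell_le (filter (\<lambda>p. snd p = k) z)"
    using assms by (rule sorted_wrt_filter)
  then show ?thesis
    unfolding sorted_map by (rule sorted_wrt_mono_rel[rotated]) (auto simp: cell_le_def)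
qed

text \<open>Row lengths are letter counts, and column strictness and the lattice condition are the
  same inequalities between numbers of cells. The reading order makes the rows sorted.\<close>

lemma rows_of_cells_in_ssyt_iff:
  assumes "sorted_wrt (\<ge>) \<mu>" "sorted_wrt cell_le z" "\<forall>p\<in>set z. snd p < length \<mu>"
  shows "rows_of_cells (length \<mu>) z \<in> ssyt \<mu> \<longleftrightarrow>
    map snd z \<in> yamanouchi \<mu> \<and> (\<forall>p\<in>set z. 1 \<le> fst p)"
proof -
  define T where "T = rows_of_cells (length \<mu>) z"
  have len: "length (T ! k) = count_list (map snd z) k" if "k < length \<mu>" for k
    using that by (simp add: T_def count_list_map_snd)
  have sorted: "sorted (T ! k)" if "k < length \<mu>" for k
    using that sorted_row_of_cells[OF assms(2)] by (simp add: T_def)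
  have shape: "map length T = \<mu> \<longleftrightarrow>
      (\<forall>i. count_list (map snd z) i = (if i < length \<mu> then \<mu> ! i else 0))"
  proof -
    have "count_list (map snd z) i = 0" if "\<not> i < length \<mu>" for i
      using assms(3) that by (auto simp: count_list_0_iff)
    then have "(\<forall>i. count_list (map snd z) i = (if i < length \<mu> then \<mu> ! i else 0)) \<longleftrightarrow>
        (\<forall>i<length \<mu>. count_list (map snd z) i = \<mu> ! i)"
      by auto
    also have "\<dots> \<longleftrightarrow> map length T = \<mu>"
      using len by (auto simp: list_eq_iff_nth_eq T_def)
    finally show ?thesis by simp
  qed
  have counts: "(\<forall>e. length (filter (\<lambda>p. snd p = Suc k \<and> fst p \<le> e) z) \<le>
        length (filter (\<lambda>p. snd p = k \<and> fst p < e) z)) \<longleftrightarrow>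
      (Suc k < length \<mu> \<longrightarrow> length (T ! Suc k) \<le> length (T ! k) \<and>
        (\<forall>j<length (T ! Suc k). T ! k ! j < T ! Suc k ! j))" for k
  proof (cases "Suc k < length \<mu>")
    case True
    have "length (filter (\<lambda>p. snd p = Suc k \<and> fst p \<le> e) z) = length (filter (\<lambda>y. y \<le> e) (T ! Suc k))"
      "length (filter (\<lambda>p. snd p = k \<and> fst p < e) z) = length (filter (\<lambda>x. x < e) (T ! k))" for e
      using True by (simp_all add: T_def filter_map comp_def conj_commute)
    then show ?thesis
      using True column_strict_iff_counts[OF sorted[of k] sorted[of "Suc k"]] by simp
  next
    case False
    then have "filter (\<lambda>p. snd p = Suc k \<and> fst p \<le> e) z = []" for e
      using assms(3) by (auto simp: filter_empty_conv)
    then show ?thesis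
      using False by simp
  qed
  have lattice: "lattice_word (map snd z) \<longleftrightarrow>
      (\<forall>k. Suc k < length \<mu> \<longrightarrow> (\<forall>j<length (T ! Suc k). T ! k ! j < T ! Suc k ! j))"
    if shape: "map length T = \<mu>"
  proof -
    have "length (T ! Suc k) \<le> length (T ! k)" if "Suc k < length \<mu>" for k
    proof -
      have "length (T ! k) = \<mu> ! k" "length (T ! Suc k) = \<mu> ! Suc k"
        using that shape nth_map[of _ T length] by (auto simp: T_def)
      then show ?thesis
        using assms(1) that by (simp add: sorted_wrt_iff_nth_less)
    qed
    then show ?thesis
      unfolding lattice_word_iff_cell_counts[OF assms(2)] counts by blast
  qed
  have pos: "(\<forall>r\<in>set T. \<forall>k\<in>set r. 1 \<le> k) \<longleftrightarrow> (\<forall>p\<in>set z. 1 \<le> fst p)"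
    using assms(3) by (fastforce simp: T_def rows_of_cells_def)
  have "\<forall>r\<in>set T. sorted r"
    using sorted by (auto simp: in_set_conv_nth T_def)
  moreover have "length T = length \<mu>"
    by (simp add: T_def)
  ultimately have "T \<in> ssyt \<mu> \<longleftrightarrow> map length T = \<mu> \<and> (\<forall>r\<in>set T. \<forall>k\<in>set r. 1 \<le> k) \<and>
      (\<forall>k. Suc k < length \<mu> \<longrightarrow> (\<forall>j<length (T ! Suc k). T ! k ! j < T ! Suc k ! j))"
    unfolding ssyt_def mem_Collect_eq by (simp only:) blast
  then show ?thesis
    unfolding yamanouchi_def using lattice shape pos unfolding T_def[symmetric] by auto
qed

lemma mset_concat_filter_snd:
  "mset (concat (map (\<lambda>k. filter (\<lambda>p. snd p = k) z) [0..<n])) = mset (filter (\<lambda>p. snd p < n) z)"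
proof (induction n)
  case (Suc n)
  have "mset (filter (\<lambda>p. snd p < Suc n) z) =
      mset (filter (\<lambda>p. snd p < n) z) + mset (filter (\<lambda>p. snd p = n) z)"
    by (induction z) (auto simp: less_Suc_eq)
  then show ?case
    using Suc by simp
qed simp

lemma mset_concat_rows_of_cells:
  assumes "\<forall>p\<in>set z. snd p < n"
  shows "mset (concat (rows_of_cells n z)) = mset (map fst z)"
proof -
  have "concat (rows_of_cells n z) =
      map fst (concat (map (\<lambda>k. filter (\<lambda>p. snd p = k) z) [0..<n]))"
    by (simp add: rows_of_cells_def map_concat comp_def)
  then show ?thesis
    using assms by (simp only: mset_map mset_concat_filter_snd) (simp add: filter_True)
qed

lemma rows_of_cells_inject:
  assumes "\<forall>p\<in>set z. snd p < n" "\<forall>p\<in>set z'. snd p < n"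
    and "sorted_wrt cell_le z" "sorted_wrt cell_le z'" "rows_of_cells n z = rows_of_cells n z'"
  shows "z = z'"
proof -
  have row: "filter (\<lambda>p. snd p = k) y = map (\<lambda>e. (e, k)) (map fst (filter (\<lambda>p. snd p = k) y))"
    for k :: nat and y :: "(nat \<times> nat) list"
    by (induction y) auto
  have "filter (\<lambda>p. snd p = k) z = filter (\<lambda>p. snd p = k) z'" if "k < n" for k
    using nth_rows_of_cells[OF that, of z] nth_rows_of_cells[OF that, of z'] assms(5)
      row[of k z] row[of k z'] by simp
  then have "map (\<lambda>k. filter (\<lambda>p. snd p = k) z) [0..<n] = map (\<lambda>k. filter (\<lambda>p. snd p = k) z') [0..<n]"
    by simp
  then have "mset (filter (\<lambda>p. snd p < n) z) = mset (filter (\<lambda>p. snd p < n) z')"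
    by (simp only: mset_concat_filter_snd[symmetric])
  then have "mset z = mset z'"
    using assms(1,2) by (simp add: filter_True del: mset_filter)
  then show ?thesis
    using assms(3,4) by (rule sorted_cells_unique)
qed

lemma exists_cells_of_rows:
  assumes "\<forall>r\<in>set T. sorted r"
  shows "\<exists>z. sorted_wrt cell_le z \<and> (\<forall>p\<in>set z. snd p < length T) \<and> rows_of_cells (length T) z = T"
proof -
  define zs where "zs = concat (map (\<lambda>k. map (\<lambda>e. (e, k)) (T ! k)) [0..<length T])"
  obtain z where z: "mset z = mset zs" "sorted_wrt cell_le z"
    using exists_sorted_cells by blast
  have set_z: "set z = set zs"
    using z(1) by (metis set_mset_mset)
  then have "\<forall>p\<in>set z. snd p < length T"
    by (auto simp: zs_def)
  moreover have "rows_of_cells (length T) z = T"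
  proof (rule nth_equalityI)
    fix k assume "k < length (rows_of_cells (length T) z)"
    then have k: "k < length T" by simp
    have "filter (\<lambda>p. snd p = k) zs = map (\<lambda>e. (e, k)) (T ! k)"
    proof -
      have "filter (\<lambda>p. snd p = k) (concat (map (\<lambda>i. map (\<lambda>e. (e, i)) (T ! i)) [0..<n])) =
          (if k < n then map (\<lambda>e. (e, k)) (T ! k) else [])" for n
        by (induction n) (auto simp: filter_map comp_def less_Suc_eq)
      then show ?thesis
        using k by (simp add: zs_def)
    qed
    moreover have "sorted_wrt cell_le (map (\<lambda>e. (e, k)) (T ! k))"
    proof -
      have "sorted (T ! k)"
        using assms k by simp
      then show ?thesis
        unfolding sorted_wrt_map by (rule sorted_wrt_mono_rel[rotated]) (auto simp: cell_le_def)
    qed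
    moreover have "sorted_wrt cell_le (filter (\<lambda>p. snd p = k) z)"
      using z(2) by (rule sorted_wrt_filter)
    moreover have "mset (filter (\<lambda>p. snd p = k) z) = mset (filter (\<lambda>p. snd p = k) zs)"
      using z(1) by simp
    ultimately have "filter (\<lambda>p. snd p = k) z = map (\<lambda>e. (e, k)) (T ! k)"
      using sorted_cells_unique by metis
    then show "rows_of_cells (length T) z ! k = T ! k"
      using k by (simp add: comp_def)
  qed simp
  ultimately show ?thesis
    using z(2) by blast
qed

text \<open>Sorted lists of cells mediate between the two sides: grouping by row yields tableaux,
  unzipping yields Yamanouchi words with compatible sequences.\<close>

lemma schur_eq_words_series:
  assumes "is_partition \<mu>"
  shows "schur \<mu> m = words_series (yamanouchi \<mu>) m"
proof -
  have \<mu>: "sorted_wrt (\<ge>) \<mu>"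
    using assms by (simp add: is_partition_def)
  define Z where "Z = {z. sorted_wrt cell_le z \<and> map snd z \<in> yamanouchi \<mu> \<and>
    (\<forall>p\<in>set z. 1 \<le> fst p) \<and> mset (map fst z) = m}"
  have letters: "\<forall>p\<in>set z. snd p < length \<mu>" if "map snd z \<in> yamanouchi \<mu>" for z :: "(nat \<times> nat) list"
    using yamanouchi_letters[OF that] by auto
  have "inj_on (rows_of_cells (length \<mu>)) Z"
    by (rule inj_onI) (auto simp: Z_def intro: rows_of_cells_inject[OF letters letters])
  moreover have "rows_of_cells (length \<mu>) ` Z = {T \<in> ssyt \<mu>. mset (concat T) = m}"
  proof (intro set_eqI iffI)
    fix T assume "T \<in> rows_of_cells (length \<mu>) ` Z"
    then obtain z where z: "T = rows_of_cells (length \<mu>) z" "z \<in> Z"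
      by blast
    then show "T \<in> {T \<in> ssyt \<mu>. mset (concat T) = m}"
      using rows_of_cells_in_ssyt_iff[OF \<mu>, of z] mset_concat_rows_of_cells[of z "length \<mu>"]
        letters[of z] by (simp add: Z_def)
  next
    fix T assume T: "T \<in> {T \<in> ssyt \<mu>. mset (concat T) = m}"
    then have "length T = length \<mu>" "\<forall>r\<in>set T. sorted r"
      by (auto simp: ssyt_def)
    then obtain z where z: "sorted_wrt cell_le z" "\<forall>p\<in>set z. snd p < length \<mu>"
      "rows_of_cells (length \<mu>) z = T"
      using exists_cells_of_rows[of T] by metis
    then have "z \<in> Z"
      using rows_of_cells_in_ssyt_iff[OF \<mu> z(1,2)] mset_concat_rows_of_cells[OF z(2)] T
      by (simp add: Z_def)
    then show "T \<in> rows_of_cells (length \<mu>) ` Z"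
      using z(3) by blast
  qed
  ultimately have "schur \<mu> m = card Z"
    unfolding schur_def by (metis card_image)
  also have "\<dots> = words_series (yamanouchi \<mu>) m"
  proof -
    define Y where "Y = {(r, i). r \<in> yamanouchi \<mu> \<and> i \<in> compatible_seqs r \<and> mset i = m}"
    have len: "length i = length r" if "i \<in> compatible_seqs r" for i r
      using that by (simp add: compatible_seqs_def)
    have "bij_betw (\<lambda>z. (map snd z, map fst z)) Z Y"
    proof (rule bij_betw_byWitness[where f' = "\<lambda>(r, i). zip i r"])
      show "\<forall>z\<in>Z. (\<lambda>(r, i). zip i r) (map snd z, map fst z) = z"
        by (simp add: zip_map_fst_snd)
      show "\<forall>x\<in>Y. (\<lambda>z. (map snd z, map fst z)) ((\<lambda>(r, i). zip i r) x) = x"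
        using len by (auto simp: Y_def)
      show "(\<lambda>z. (map snd z, map fst z)) ` Z \<subseteq> Y"
        by (auto simp: Z_def Y_def compatible_seqs_iff_cells zip_map_fst_snd)
      show "(\<lambda>(r, i). zip i r) ` Y \<subseteq> Z"
      proof
        fix z assume "z \<in> (\<lambda>(r, i). zip i r) ` Y"
        then obtain r i where z: "z = zip i r" "r \<in> yamanouchi \<mu>" "i \<in> compatible_seqs r" "mset i = m"
          by (auto simp: Y_def)
        then show "z \<in> Z"
          using len[OF z(3)] compatible_seqs_iff_cells[OF len[OF z(3)]]
          by (auto simp: Z_def dest: set_zip_leftD simp flip: mset_map)
      qed
    qed
    then show ?thesis
      unfolding words_series_def Y_def[symmetric] by (rule bij_betw_same_card)
  qed
  finally show ?thesis .
qed

section \<open>The extreme terms of the expansion\<close>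

text \<open>On the right stand Kostka numbers weighted by the coefficients; this is the only form in
  which the expansion is used from here on.\<close>

lemma card_reduced_words_blocks:
  assumes "fin_perm w" "has_schur_expansion (stanley w) c" "asc_invariant (blocks R \<alpha>)"
  shows "card {a \<in> reduced_words w. blocks R \<alpha> a} =
    (\<Sum>\<mu> | c \<mu> \<noteq> 0. c \<mu> * card {r \<in> yamanouchi \<mu>. blocks R \<alpha> r})"
proof -
  have series: "words_series (reduced_words w) m =
      (\<Sum>\<mu> | c \<mu> \<noteq> 0. c \<mu> * words_series (yamanouchi \<mu>) m)" for m
  proof -
    have "words_series (reduced_words w) m = (\<Sum>\<mu> | c \<mu> \<noteq> 0. c \<mu> * schur \<mu> m)"
      using assms(2) by (simp add: has_schur_expansion_def stanley_def words_series_def)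
    also have "\<dots> = (\<Sum>\<mu> | c \<mu> \<noteq> 0. c \<mu> * words_series (yamanouchi \<mu>) m)"
    proof (rule sum.cong)
      fix \<mu> assume "\<mu> \<in> {\<mu>. c \<mu> \<noteq> 0}"
      then have "is_partition \<mu>"
        using assms(2) by (simp add: has_schur_expansion_def)
      then show "c \<mu> * schur \<mu> m = c \<mu> * words_series (yamanouchi \<mu>) m"
        by (simp add: schur_eq_words_series)
    qed simp
    finally show ?thesis .
  qed
  have "{a \<in> W. length a = sum_list \<alpha> \<and> blocks R \<alpha> a} = {a \<in> W. blocks R \<alpha> a}" for W
    using length_blocks by blast
  then show ?thesis
    using card_words_transfer[OF finite_reduced_words[OF assms(1)] finite_yamanouchi series assms(3),
        of "sum_list \<alpha>"] by simp
qed

text \<open>A sum of products of natural numbers that equals 1 has a product equal to 1, whose two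
  factors are then 1.\<close>

lemma expansion_coeff_1:
  assumes "fin_perm w" "has_schur_expansion (stanley w) c" "asc_invariant (blocks R \<alpha>)"
    and "\<exists>!a. a \<in> reduced_words w \<and> blocks R \<alpha> a"
  shows "\<exists>\<mu>. c \<mu> = 1 \<and> (\<exists>r\<in>yamanouchi \<mu>. blocks R \<alpha> r)"
proof -
  obtain a where "{a \<in> reduced_words w. blocks R \<alpha> a} = {a}"
    using assms(4) by blast
  then have "(\<Sum>\<mu> | c \<mu> \<noteq> 0. c \<mu> * card {r \<in> yamanouchi \<mu>. blocks R \<alpha> r}) = 1"
    using card_reduced_words_blocks[OF assms(1-3)] by simp
  moreover have fin: "finite {\<mu>. c \<mu> \<noteq> 0}"
    using assms(2) by (simp add: has_schur_expansion_def)
  ultimately obtain \<mu> where "c \<mu> * card {r \<in> yamanouchi \<mu>. blocks R \<alpha> r} = 1"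
    unfolding sum_eq_1_iff[OF fin] by blast
  then have "c \<mu> = 1" "card {r \<in> yamanouchi \<mu>. blocks R \<alpha> r} = 1"
    by (simp_all only: nat_mult_eq_1_iff)
  moreover from this(2) obtain r where "{r \<in> yamanouchi \<mu>. blocks R \<alpha> r} = {r}"
    by (auto simp: card_1_singleton_iff)
  ultimately show ?thesis
    by blast
qed

text \<open>Natural coefficients do not cancel, so one suitable Yamanouchi word of an occurring
  shape makes the count of reduced words positive.\<close>

lemma exists_reduced_word_blocks:
  assumes "fin_perm w" "has_schur_expansion (stanley w) c" "asc_invariant (blocks R \<alpha>)"
    and "c \<nu> \<noteq> 0" "r \<in> yamanouchi \<nu>" "blocks R \<alpha> r"
  shows "\<exists>a\<in>reduced_words w. blocks R \<alpha> a"
proof -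
  have "finite {\<mu>. c \<mu> \<noteq> 0}"
    using assms(2) by (simp add: has_schur_expansion_def)
  then have "c \<nu> * card {r \<in> yamanouchi \<nu>. blocks R \<alpha> r} \<le> card {a \<in> reduced_words w. blocks R \<alpha> a}"
    unfolding card_reduced_words_blocks[OF assms(1-3)] using assms(4)
    by (intro member_le_sum[of \<nu>]) auto
  moreover have "card {r \<in> yamanouchi \<nu>. blocks R \<alpha> r} \<noteq> 0"
    using assms(5,6) finite_yamanouchi[of \<nu>] by (auto simp: card_eq_0_iff)
  ultimately have "card {a \<in> reduced_words w. blocks R \<alpha> a} \<noteq> 0"
    using assms(4) by (metis le_zero_eq mult_eq_0_iff)
  then have "{a \<in> reduced_words w. blocks R \<alpha> a} \<noteq> {}"
    by force
  then show ?thesis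
    by blast
qed

text \<open>The conjugate code \<open>\<kappa>\<close> separates the shapes: each occurring
  \<open>\<nu>\<close> is the list of block lengths of a reduced word and stays below
  \<open>\<kappa>\<close>, while the shape accounting for the unique word with block lengths
  \<open>\<kappa>\<close> lies above it.\<close>

lemma expansion_dominance_max:
  assumes "fin_perm w" "has_schur_expansion (stanley w) c"
  shows "\<exists>\<mu>. c \<mu> = 1 \<and> (\<forall>\<nu> k. c \<nu> \<noteq> 0 \<longrightarrow> sum_list (take k \<nu>) \<le> sum_list (take k \<mu>))"
proof -
  define V K where "V = {v. 0 < code w v}" and "K = card (inversions w)"
  have V: "finite V" "{v. 0 < code w v} \<subseteq> V"
    using finite_code_pos[OF assms(1)] by (simp_all add: V_def)
  have K: "code w v \<le> K" for v
    using code_le_card_inversions[OF assms(1)] by (simp add: K_def)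
  define \<kappa> where "\<kappa> = conjugate V (code w) K"
  have "a \<in> reduced_words w \<and> blocks (\<ge>) \<kappa> a \<longleftrightarrow> descents w a \<and> act w a = id \<and> blocks (>) \<kappa> a" for a
    using reduced_words_eq[OF assms(1)] descents_blocks_strict[OF assms(1)] blocks_strict_weak by blast
  then have "\<exists>!a. a \<in> reduced_words w \<and> blocks (\<ge>) \<kappa> a"
    using exists1_conjugate_blocks[OF assms(1) V K] by (simp only: \<kappa>_def)
  then obtain \<mu> r where \<mu>: "c \<mu> = 1" "r \<in> yamanouchi \<mu>" "blocks (\<ge>) \<kappa> r"
    using expansion_coeff_1[OF assms asc_invariant_blocks_ge] by blast
  have "sum_list (take k \<nu>) \<le> sum_list (take k \<mu>)" if \<nu>: "c \<nu> \<noteq> 0" for \<nu> k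
  proof -
    have "sorted_wrt (\<ge>) \<nu>"
      using assms(2) \<nu> by (simp add: has_schur_expansion_def is_partition_def)
    then obtain s where "s \<in> yamanouchi \<nu>" "blocks (\<ge>) \<nu> s"
      using exists_yamanouchi_decreasing by blast
    then obtain a where "a \<in> reduced_words w" "blocks (\<ge>) \<nu> a"
      using exists_reduced_word_blocks[OF assms asc_invariant_blocks_ge \<nu>] by blast
    then have "descents w a" "blocks (>) \<nu> a"
      using reduced_words_eq[OF assms(1)] descents_blocks_strict[OF assms(1)] by blast+
    then have "sum_list (take k \<nu>) \<le> (\<Sum>v\<in>V. min (code w v) k)"
      using sum_list_take_blocks_le[OF assms(1) _ _ V] by blast
    also have "\<dots> = sum_list (take k \<kappa>)"
      unfolding \<kappa>_def using V(1) K by (intro sum_list_take_conjugate[symmetric])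
    also have "\<dots> \<le> sum_list (take k \<mu>)"
      using \<mu>(2,3) by (rule yamanouchi_decreasing_blocks_le)
    finally show ?thesis .
  qed
  then show ?thesis
    using \<mu>(1) by blast
qed

text \<open>
  Reversing words exchanges \<open>w\<close> with its inverse and decreasing with increasing blocks, so the
  code of the inverse yields the conjugate bound.
\<close>

lemma expansion_dominance_min:
  assumes "fin_perm w" "has_schur_expansion (stanley w) c"
  shows "\<exists>\<mu>. c \<mu> = 1 \<and>
    (\<forall>\<nu> k. c \<nu> \<noteq> 0 \<longrightarrow> (\<Sum>i<length \<nu>. min (\<nu> ! i) k) \<le> (\<Sum>i<length \<mu>. min (\<mu> ! i) k))"
proof -
  define u where "u = inv w"
  have u: "fin_perm u"
    using fin_perm_inv[OF assms(1)] by (simp add: u_def)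
  have rev: "a \<in> reduced_words w \<longleftrightarrow> rev a \<in> reduced_words u" for a
    using rev_in_reduced_words_inv_iff[OF assms(1)] by (simp add: u_def)
  define V K where "V = {v. 0 < code u v}" and "K = card (inversions u)"
  have V: "finite V" "{v. 0 < code u v} \<subseteq> V"
    using finite_code_pos[OF u] by (simp_all add: V_def)
  have K: "code u v \<le> K" for v
    using code_le_card_inversions[OF u] by (simp add: K_def)
  define \<kappa> where "\<kappa> = conjugate V (code u) K"
  have "\<exists>!a. descents u a \<and> act u a = id \<and> blocks (>) \<kappa> a"
    using exists1_conjugate_blocks[OF u V K] by (simp only: \<kappa>_def)
  then obtain b where b: "descents u b \<and> act u b = id \<and> blocks (>) \<kappa> b"
    and unique: "\<And>a. descents u a \<and> act u a = id \<and> blocks (>) \<kappa> a \<Longrightarrow> a = b"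
    by blast
  have iff: "a \<in> reduced_words w \<and> blocks (<) (rev \<kappa>) a \<longleftrightarrow>
      descents u (rev a) \<and> act u (rev a) = id \<and> blocks (>) \<kappa> (rev a)" for a
    using reduced_words_eq[OF u] rev[of a] by (simp add: blocks_rev)
  have "\<exists>!a. a \<in> reduced_words w \<and> blocks (<) (rev \<kappa>) a"
  proof (rule ex1I[of _ "rev b"])
    show "rev b \<in> reduced_words w \<and> blocks (<) (rev \<kappa>) (rev b)"
      using b by (simp add: iff)
    show "a = rev b" if "a \<in> reduced_words w \<and> blocks (<) (rev \<kappa>) a" for a
      using that unique[of "rev a"] unfolding iff by (metis rev_rev_ident)
  qed
  then obtain \<mu> r where \<mu>: "c \<mu> = 1" "r \<in> yamanouchi \<mu>" "blocks (<) (rev \<kappa>) r"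
    using expansion_coeff_1[OF assms asc_invariant_blocks_less] by blast
  have "(\<Sum>i<length \<nu>. min (\<nu> ! i) k) \<le> (\<Sum>i<length \<mu>. min (\<mu> ! i) k)" if \<nu>: "c \<nu> \<noteq> 0" for \<nu> k
  proof -
    have sorted: "sorted_wrt (\<ge>) \<nu>"
      using assms(2) \<nu> by (simp add: has_schur_expansion_def is_partition_def)
    \<comment> \<open>Increasing blocks are columns, so \<open>\<nu>\<close> enters through its
      conjugate; \<open>sum_list \<nu>\<close> is merely a convenient bound for its parts.\<close>
    define \<nu>' where "\<nu>' = conjugate {..<length \<nu>} ((!) \<nu>) (sum_list \<nu>)"
    have parts: "\<forall>i<length \<nu>. \<nu> ! i \<le> sum_list \<nu>"
      by (simp add: elem_le_sum_list)
    obtain s where "s \<in> yamanouchi \<nu>" "blocks (<) (rev \<nu>') s"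
      using exists_yamanouchi_increasing[OF sorted parts] unfolding \<nu>'_def by blast
    then obtain a where a: "a \<in> reduced_words w" "blocks (<) (rev \<nu>') a"
      using exists_reduced_word_blocks[OF assms asc_invariant_blocks_less \<nu>] by blast
    have "(\<Sum>i<length \<nu>. min (\<nu> ! i) k) = sum_list (take k \<nu>')"
      unfolding \<nu>'_def using parts by (intro sum_list_take_conjugate[symmetric]) auto
    also have "\<dots> \<le> (\<Sum>v\<in>V. min (code u v) k)"
    proof (rule sum_list_take_blocks_le[OF u _ _ V])
      show "descents u (rev a)"
        using a(1) rev reduced_words_eq[OF u] by blast
      show "blocks (>) \<nu>' (rev a)"
        using a(2) by (simp add: blocks_rev)
    qed
    also have "\<dots> = sum_list (take k \<kappa>)"
      unfolding \<kappa>_def using V(1) K by (intro sum_list_take_conjugate[symmetric])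
    also have "\<dots> \<le> (\<Sum>i<length \<mu>. min (\<mu> ! i) k)"
      using \<mu>(2,3) by (rule yamanouchi_increasing_blocks_le)
    finally show ?thesis .
  qed
  then show ?thesis
    using \<mu>(1) by blast
qed

lemma expansion_size:
  assumes "fin_perm w" "has_schur_expansion (stanley w) c" "c \<nu> \<noteq> 0"
  shows "sum_list \<nu> = coxeter_length w"
proof -
  have "sorted_wrt (\<ge>) \<nu>"
    using assms(2,3) by (simp add: has_schur_expansion_def is_partition_def)
  then obtain s where "s \<in> yamanouchi \<nu>" "blocks (\<ge>) \<nu> s"
    using exists_yamanouchi_decreasing by blast
  then obtain a where "a \<in> reduced_words w" "blocks (\<ge>) \<nu> a"
    using exists_reduced_word_blocks[OF assms(1,2) asc_invariant_blocks_ge assms(3)] by blast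
  then show ?thesis
    using length_blocks by (force simp: reduced_words_def)
qed

section \<open>Comparing partitions\<close>

lemma partition_sum_0: "is_partition \<mu> \<Longrightarrow> sum_list \<mu> = 0 \<Longrightarrow> \<mu> = []"
  by (cases \<mu>) (auto simp: is_partition_def)

text \<open>Conjugation reverses dominance, so the two bounds enclose \<open>\<nu>\<close>.
  Concretely, truncating at the first part of \<open>\<nu>\<close> loses no cell of
  \<open>\<nu>\<close> but would lose cells of \<open>\<mu>\<close> if its first part were
  larger.\<close>

lemma partition_eqI:
  assumes "is_partition \<nu>" "is_partition \<mu>" "sum_list \<nu> = sum_list \<mu>"
    and "\<And>k. sum_list (take k \<nu>) \<le> sum_list (take k \<mu>)"
    and "\<And>k. sum_list (map (\<lambda>x. min x k) \<nu>) \<le> sum_list (map (\<lambda>x. min x k) \<mu>)"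
  shows "\<nu> = \<mu>"
  using assms
proof (induction \<nu> arbitrary: \<mu>)
  case Nil
  then show ?case
    using partition_sum_0[of \<mu>] by simp
next
  case (Cons x \<nu>)
  then obtain y \<mu>' where \<mu>: "\<mu> = y # \<mu>'"
    using partition_sum_0[of "x # \<nu>"] by (cases \<mu>) auto
  have "x \<le> y"
    using Cons.prems(4)[of 1] \<mu> by simp
  moreover have "\<not> x < y"
  proof
    assume "x < y"
    have "map (\<lambda>z. min z x) (x # \<nu>) = x # \<nu>"
      using Cons.prems(1) by (intro map_idI) (auto simp: is_partition_def)
    then have "sum_list (x # \<nu>) \<le> sum_list (map (\<lambda>z. min z x) \<mu>)"
      using Cons.prems(5)[of x] by simp
    also have "\<dots> < sum_list \<mu>"
    proof -
      have "sum_list (map (\<lambda>z. min z x) \<mu>') \<le> sum_list (map (\<lambda>z. z) \<mu>')"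
        by (intro sum_list_mono) simp
      then show ?thesis
        using \<open>x < y\<close> by (simp add: \<mu>)
    qed
    finally show False
      using Cons.prems(3) by simp
  qed
  ultimately have "x = y" by simp
  have "\<nu> = \<mu>'"
  proof (rule Cons.IH)
    show "is_partition \<nu>" "is_partition \<mu>'" "sum_list \<nu> = sum_list \<mu>'"
      using Cons.prems(1-3) \<mu> \<open>x = y\<close> by (auto simp: is_partition_def)
    show "sum_list (take k \<nu>) \<le> sum_list (take k \<mu>')" for k
      using Cons.prems(4)[of "Suc k"] \<mu> \<open>x = y\<close> by simp
    show "sum_list (map (\<lambda>x. min x k) \<nu>) \<le> sum_list (map (\<lambda>x. min x k) \<mu>')" for k
      using Cons.prems(5)[of k] \<mu> \<open>x = y\<close> by simp
  qed
  then show ?case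
    using \<mu> \<open>x = y\<close> by simp
qed

text \<open>Partial sums do not see trailing zeros; these are excluded by the positivity of
  parts.\<close>

lemma partition_eq_take_sums:
  assumes "is_partition \<nu>" "is_partition \<mu>"
    and "\<And>k. sum_list (take k \<nu>) = sum_list (take k \<mu>)"
  shows "\<nu> = \<mu>"
  using assms
proof (induction \<nu> arbitrary: \<mu>)
  case Nil
  then show ?case
    using Nil.prems(3)[of "length \<mu>"] partition_sum_0[of \<mu>] by simp
next
  case (Cons x \<nu>)
  then obtain y \<mu>' where \<mu>: "\<mu> = y # \<mu>'"
    using partition_sum_0[of "x # \<nu>"] Cons.prems(3)[of "Suc (length \<nu>)"] by (cases \<mu>) auto
  have "x = y"
    using Cons.prems(3)[of 1] \<mu> by simp
  moreover have "\<nu> = \<mu>'"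
  proof (rule Cons.IH)
    show "is_partition \<nu>" "is_partition \<mu>'"
      using Cons.prems(1,2) \<mu> by (auto simp: is_partition_def)
    show "sum_list (take k \<nu>) = sum_list (take k \<mu>')" for k
      using Cons.prems(3)[of "Suc k"] \<mu> \<open>x = y\<close> by simp
  qed
  ultimately show ?case
    using \<mu> by simp
qed

section \<open>Uniqueness of the Schur expansion\<close>

text \<open>Triangularity of the Kostka numbers: if \<open>\<mu>\<close> is dominance-maximal among
  the shapes with different coefficients, counting words with block lengths \<open>\<mu>\<close>
  involves only shapes above \<open>\<mu>\<close>, where the two expansions agree except possibly at
  \<open>\<mu>\<close> itself.\<close>

lemma schur_expansion_unique:
  assumes w: "fin_perm w"
    and c: "has_schur_expansion (stanley w) c" "has_schur_expansion (stanley w) c'"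
  shows "c = c'"
proof (rule ccontr)
  assume "c \<noteq> c'"
  define D where "D = {\<mu>. c \<mu> \<noteq> c' \<mu>}"
  define I where "I = {\<mu>. c \<mu> \<noteq> 0} \<union> {\<mu>. c' \<mu> \<noteq> 0}"
  define dom where "dom \<mu> \<nu> \<longleftrightarrow> (\<forall>k. sum_list (take k \<mu>) \<le> sum_list (take k \<nu>)) \<and>
    (\<exists>k. sum_list (take k \<mu>) < sum_list (take k \<nu>))" for \<mu> \<nu> :: "nat list"
  have "finite I"
    using c by (simp add: I_def has_schur_expansion_def)
  have "D \<subseteq> I"
    by (auto simp: D_def I_def)
  then have "finite D"
    using \<open>finite I\<close> by (rule finite_subset)
  have partition: "is_partition \<mu>" if "\<mu> \<in> I" for \<mu>
    using c that by (auto simp: I_def has_schur_expansion_def)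
  have "D \<noteq> {}"
    using \<open>c \<noteq> c'\<close> by (auto simp: D_def)
  moreover have "asymp_on D dom"
    by (rule asymp_onI) (auto simp: dom_def not_less)
  moreover have "transp_on D dom"
    unfolding dom_def by (rule transp_onI) (meson le_trans less_le_trans)
  ultimately obtain \<mu> where \<mu>: "\<mu> \<in> D" "\<And>\<nu>. \<nu> \<in> D \<Longrightarrow> \<nu> \<noteq> \<mu> \<Longrightarrow> \<not> dom \<mu> \<nu>"
    using Finite_Set.bex_max_element[OF \<open>finite D\<close>] by blast
  have "\<mu> \<in> I"
    using \<mu>(1) \<open>D \<subseteq> I\<close> by blast
  define d where "d \<nu> = card {r \<in> yamanouchi \<nu>. blocks (\<ge>) \<mu> r}" for \<nu>
  \<comment> \<open>The supports of \<open>c\<close> and \<open>c'\<close> may differ; padding with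
    zero terms lets both sums run over \<open>I\<close>.\<close>
  have extend: "(\<Sum>\<nu> | b \<nu> \<noteq> 0. b \<nu> * d \<nu>) = (\<Sum>\<nu>\<in>I. b \<nu> * d \<nu>)" if "{\<nu>. b \<nu> \<noteq> 0} \<subseteq> I" for b
    using that \<open>finite I\<close> by (intro sum.mono_neutral_left) auto
  have "(\<Sum>\<nu>\<in>I. c \<nu> * d \<nu>) = (\<Sum>\<nu>\<in>I. c' \<nu> * d \<nu>)"
    using card_reduced_words_blocks[OF w c(1) asc_invariant_blocks_ge[of \<mu>]]
      card_reduced_words_blocks[OF w c(2) asc_invariant_blocks_ge[of \<mu>]]
      extend[of c] extend[of c'] by (simp add: d_def I_def)
  moreover have "(\<Sum>\<nu>\<in>I - {\<mu>}. c \<nu> * d \<nu>) = (\<Sum>\<nu>\<in>I - {\<mu>}. c' \<nu> * d \<nu>)"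
  proof (rule sum.cong)
    fix \<nu> assume \<nu>: "\<nu> \<in> I - {\<mu>}"
    show "c \<nu> * d \<nu> = c' \<nu> * d \<nu>"
    proof (cases "\<nu> \<in> D \<and> d \<nu> \<noteq> 0")
      case True
      then have "{r \<in> yamanouchi \<nu>. blocks (\<ge>) \<mu> r} \<noteq> {}"
        unfolding d_def by force
      then obtain r where "r \<in> yamanouchi \<nu>" "blocks (\<ge>) \<mu> r"
        by blast
      then have le: "sum_list (take k \<mu>) \<le> sum_list (take k \<nu>)" for k
        by (rule yamanouchi_decreasing_blocks_le)
      have "\<not> dom \<mu> \<nu>"
        using \<mu>(2) \<nu> True by blast
      then have "sum_list (take k \<mu>) = sum_list (take k \<nu>)" for k
        using le by (meson dom_def le_neq_implies_less)
      then have "\<mu> = \<nu>"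
        using partition_eq_take_sums[OF partition[OF \<open>\<mu> \<in> I\<close>] partition] \<nu> by blast
      then show ?thesis
        using \<nu> by blast
    qed (auto simp: D_def)
  qed simp
  ultimately have "c \<mu> * d \<mu> = c' \<mu> * d \<mu>"
    using sum.remove[OF \<open>finite I\<close> \<open>\<mu> \<in> I\<close>, of "\<lambda>\<nu>. c \<nu> * d \<nu>"]
      sum.remove[OF \<open>finite I\<close> \<open>\<mu> \<in> I\<close>, of "\<lambda>\<nu>. c' \<nu> * d \<nu>"] by simp
  moreover have "d \<mu> \<noteq> 0"
  proof -
    have "{r \<in> yamanouchi \<mu>. blocks (\<ge>) \<mu> r} \<noteq> {}"
      using exists_yamanouchi_decreasing[of \<mu>] partition[OF \<open>\<mu> \<in> I\<close>] by (auto simp: is_partition_def)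
    then show ?thesis
      using finite_yamanouchi[of \<mu>] by (simp add: d_def)
  qed
  ultimately show False
    using \<mu>(1) by (simp add: D_def)
qed

theorem lemma7p1:
  fixes n :: nat and w :: "nat \<Rightarrow> nat"
  assumes "w permutes {1..n}"
    and "vexillary 3 w"
  shows "multiplicity_free w"
proof -
  have w: "fin_perm w"
    using assms(1) by (auto simp: fin_perm_def)
  obtain c where c: "has_schur_expansion (stanley w) c" and le: "(\<Sum>\<mu> | c \<mu> \<noteq> 0. c \<mu>) \<le> 3"
    using assms(2) by (auto simp: vexillary_def has_EG_number_def)
  have fin: "finite {\<mu>. c \<mu> \<noteq> 0}"
    using c by (simp add: has_schur_expansion_def)
  obtain \<mu> where \<mu>: "c \<mu> = 1"
    "\<And>\<nu> k. c \<nu> \<noteq> 0 \<Longrightarrow> sum_list (take k \<nu>) \<le> sum_list (take k \<mu>)"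
    using expansion_dominance_max[OF w c] by blast
  obtain \<rho> where \<rho>: "c \<rho> = 1"
    "\<And>\<nu> k. c \<nu> \<noteq> 0 \<Longrightarrow> (\<Sum>i<length \<nu>. min (\<nu> ! i) k) \<le> (\<Sum>i<length \<rho>. min (\<rho> ! i) k)"
    using expansion_dominance_min[OF w c] by blast
  have "c \<nu> = 1" if \<nu>: "c \<nu> \<noteq> 0" for \<nu>
  proof (cases "\<mu> = \<rho>")
    case True
    have min_sum: "sum_list (map (\<lambda>x. min x k) xs) = (\<Sum>i<length xs. min (xs ! i) k)"
      for k and xs :: "nat list"
      by (simp add: sum_list_sum_nth atLeast0LessThan)
    have "\<nu> = \<mu>"
    proof (rule partition_eqI)
      show "is_partition \<nu>" "is_partition \<mu>"
        using c \<nu> \<mu>(1) by (auto simp: has_schur_expansion_def)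
      show "sum_list \<nu> = sum_list \<mu>"
        using expansion_size[OF w c] \<nu> \<mu>(1) by simp
      show "sum_list (take k \<nu>) \<le> sum_list (take k \<mu>)" for k
        using \<mu>(2)[OF \<nu>] .
      show "sum_list (map (\<lambda>x. min x k) \<nu>) \<le> sum_list (map (\<lambda>x. min x k) \<mu>)" for k
        using \<rho>(2)[OF \<nu>] by (simp add: min_sum True)
    qed
    then show ?thesis
      using \<mu>(1) by simp
  next
    case False
    show ?thesis
    proof (cases "\<nu> \<in> {\<mu>, \<rho>}")
      case True
      then show ?thesis
        using \<mu>(1) \<rho>(1) by auto
    next
      case not_extreme: False
      have "(\<Sum>\<kappa>\<in>{\<mu>, \<rho>, \<nu>}. c \<kappa>) \<le> (\<Sum>\<kappa> | c \<kappa> \<noteq> 0. c \<kappa>)"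
        using fin \<nu> \<mu>(1) \<rho>(1) by (intro sum_mono2) auto
      moreover have "(\<Sum>\<kappa>\<in>{\<mu>, \<rho>, \<nu>}. c \<kappa>) = 2 + c \<nu>"
        using False not_extreme \<mu>(1) \<rho>(1) by (simp add: eq_commute[of _ \<nu>])
      ultimately show ?thesis
        using le \<nu> by simp
    qed
  qed
  then show ?thesis
    using c schur_expansion_unique[OF w c] unfolding multiplicity_free_def by blast
qed

end
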